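(* Let $k,\ell\ge 2$ be standard natural numbers. Over $\mathsf{RCA}_0$, the following are equivalent. (1) $\mathsf{Baire}\text{-}\mathsf{DRT}^k_\ell$ (the Baire Dual Ramsey Theorem for $k$ partitions and $\ell$ colors): for every Baire $\ell$-coloring $\{O_i\}_{i<\ell}$, $\{D_n\}_{n<\omega}$ of $(\omega)^k$, there are $p\in(\omega)^\omega$ and $i<\ell$ such that for all $x\in(p)^k$, $x\in O_i\cap\bigcap_n D_n$. (2) $\mathsf{ODRT}^k_\ell$: for every open $\ell$-coloring $(\omega)^k=\bigcup_{i<\ell}O_i$, there are $p\in(\omega)^\omega$ and $i<\ell$ such that for all $x\in(p)^k$, $x\in O_i$. (3) $\mathsf{CDRT}^k_\ell$: for every $c:(<\omega)^{k-1}\to\ell$, there are $p\in(\omega)^\omega$ and $i<\ell$ such that for every $x\in(p)^k$, $c(x^* )=i$.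
   Context: All definitions are made in $\mathsf{RCA}_0$; $\omega$ denotes the set of natural numbers of the model (no restriction to $\omega$-models). Partitions: a number $k$ is identified with $\{0,\dots,k-1\}$. For $k\le s\le\omega$, $(s)^k$ is the set of surjections $p:s\to k$ that are ordered, meaning $\min p^{-1}(i)<\min p^{-1}(j)$ whenever $i<j<k$ (so $p$ represents a partition of $s$ into exactly $k$ blocks $p^{-1}(i)$). $(<\omega)^k=\bigcup_{r\in\omega}(r)^k$, a set of finite strings. For $k\le s\le t\le\omega$ and $p\in(t)^s$, $(p)^k=\{x\circ p:x\in(s)^k\}$ is the set of $k$-coarsenings of $p$. For $p\in(s)^k$ with $k$ finite, $\mu^p(i)=\min p^{-1}(i)$ and $p^*=p\restriction\mu^p(k-1)\in(<\omega)^{k-1}$. For $\sigma\in(<\omega)^k$, $[\sigma]=\{p\in(\omega)^k:\sigma\prec p\}$, where $\prec$ is the initial segment relation. A code for an open set in $(\omega)^k$ is a set $O\subseteq\omega\times(<\omega)^k$; for $p\in(\omega)^k$, $p\in O$ means that $p\in[\sigma]$ for some $\langle n,\sigma\rangle\in O$. An open set $O$ is dense if for all $\tau\in(<\omega)^k$, $[\tau]\cap O\ne\emptyset$ (i.e. there is $\langle n,\sigma\rangle\in O$ with $\sigma,\tau$ comparable as strings). A Baire $\ell$-coloring of $(\omega)^k$ (given by its code) is a sequence $\{D_n\}_{n<\omega}$ of (codes for) dense open sets together with pairwise disjoint open sets $\{O_i\}_{i<\ell}$ such that $\bigcup_{i<\ell}O_i$ is dense in $(\omega)^k$. An open $\ell$-coloring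 is $(\omega)^k=\bigcup_{i<\ell}O_i$ with the $O_i$ (codes for) open and pairwise disjoint sets. *)

theory Defs
  imports Main
begin

section \<open>Structures for the language of second-order arithmetic\<close>

text \<open>
  The number sort of a structure is the whole type \<^typ>\<open>'a\<close>; the set sort is a collection of
  subsets of it.  Neither is assumed to be standard.
\<close>

record 'a l2_structure =
  zer :: 'a  ("\<zero>\<index>")
  one :: 'a  ("\<one>\<index>")
  add :: "'a \<Rightarrow> 'a \<Rightarrow> 'a"  (infixl "\<oplus>\<index>" 65)
  mul :: "'a \<Rightarrow> 'a \<Rightarrow> 'a"  (infixl "\<otimes>\<index>" 70)
  lt :: "'a \<Rightarrow> 'a \<Rightarrow> bool"  (infix "\<sqsubset>\<index>" 50)
  set_part :: "'a set set"

datatype trm = Var nat | Zero | One | Plus trm trm | Times trm trm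

datatype fm =
    Eq trm trm
  | Less trm trm
  | Mem trm nat
  | Neg fm
  | Conj fm fm
  | Ex nat fm
  | All nat fm
  | ExS nat fm
  | AllS nat fm

primrec tvars :: "trm \<Rightarrow> nat set" where
  "tvars (Var v) = {v}"
| "tvars Zero = {}"
| "tvars One = {}"
| "tvars (Plus s t) = tvars s \<union> tvars t"
| "tvars (Times s t) = tvars s \<union> tvars t"

primrec tval :: "('a, 'b) l2_structure_scheme \<Rightarrow> (nat \<Rightarrow> 'a) \<Rightarrow> trm \<Rightarrow> 'a" where
  "tval M e (Var v) = e v"
| "tval M e Zero = \<zero>\<^bsub>M\<^esub>"
| "tval M e One = \<one>\<^bsub>M\<^esub>"
| "tval M e (Plus s t) = tval M e s \<oplus>\<^bsub>M\<^esub> tval M e t"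
| "tval M e (Times s t) = tval M e s \<otimes>\<^bsub>M\<^esub> tval M e t"

text \<open>Number variables and set variables have separate valuations \<open>e\<close> and \<open>E\<close>.\<close>

primrec sat :: "('a, 'b) l2_structure_scheme \<Rightarrow> (nat \<Rightarrow> 'a) \<Rightarrow> (nat \<Rightarrow> 'a set) \<Rightarrow> fm \<Rightarrow> bool" where
  "sat M e E (Eq s t) \<longleftrightarrow> tval M e s = tval M e t"
| "sat M e E (Less s t) \<longleftrightarrow> tval M e s \<sqsubset>\<^bsub>M\<^esub> tval M e t"
| "sat M e E (Mem t V) \<longleftrightarrow> tval M e t \<in> E V"
| "sat M e E (Neg \<phi>) \<longleftrightarrow> \<not> sat M e E \<phi>"
| "sat M e E (Conj \<phi> \<psi>) \<longleftrightarrow> sat M e E \<phi> \<and> sat M e E \<psi>"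
| "sat M e E (Ex v \<phi>) \<longleftrightarrow> (\<exists>a. sat M (e(v := a)) E \<phi>)"
| "sat M e E (All v \<phi>) \<longleftrightarrow> (\<forall>a. sat M (e(v := a)) E \<phi>)"
| "sat M e E (ExS V \<phi>) \<longleftrightarrow> (\<exists>A\<in>set_part M. sat M e (E(V := A)) \<phi>)"
| "sat M e E (AllS V \<phi>) \<longleftrightarrow> (\<forall>A\<in>set_part M. sat M e (E(V := A)) \<phi>)"

text \<open>
  Bounded-quantifier formulas.  The universal bounded quantifier
  \<open>\<forall>v (v < t \<rightarrow> \<phi>)\<close> is written with negation and conjunction.
\<close>

inductive bounded_fm :: "fm \<Rightarrow> bool" where
  "bounded_fm (Eq s t)"
| "bounded_fm (Less s t)"
| "bounded_fm (Mem t V)"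
| "bounded_fm \<phi> \<Longrightarrow> bounded_fm (Neg \<phi>)"
| "bounded_fm \<phi> \<Longrightarrow> bounded_fm \<psi> \<Longrightarrow> bounded_fm (Conj \<phi> \<psi>)"
| "bounded_fm \<phi> \<Longrightarrow> v \<notin> tvars t \<Longrightarrow> bounded_fm (Ex v (Conj (Less (Var v) t) \<phi>))"
| "bounded_fm \<phi> \<Longrightarrow> v \<notin> tvars t \<Longrightarrow>
    bounded_fm (All v (Neg (Conj (Less (Var v) t) (Neg \<phi>))))"

definition sigma1 :: "fm \<Rightarrow> bool" where
  "sigma1 \<phi> \<longleftrightarrow> (\<exists>v \<theta>. bounded_fm \<theta> \<and> \<phi> = Ex v \<theta>)"

definition pi1 :: "fm \<Rightarrow> bool" where
  "pi1 \<phi> \<longleftrightarrow> (\<exists>v \<theta>. bounded_fm \<theta> \<and> \<phi> = All v \<theta>)"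

section \<open>The axioms of $\mathsf{RCA}_0$\<close>

definition basic_axioms :: "('a, 'b) l2_structure_scheme \<Rightarrow> bool" where
  "basic_axioms M \<longleftrightarrow>
     (\<forall>n. n \<oplus>\<^bsub>M\<^esub> \<one>\<^bsub>M\<^esub> \<noteq> \<zero>\<^bsub>M\<^esub>) \<and>
     (\<forall>m n. m \<oplus>\<^bsub>M\<^esub> \<one>\<^bsub>M\<^esub> = n \<oplus>\<^bsub>M\<^esub> \<one>\<^bsub>M\<^esub> \<longrightarrow> m = n) \<and>
     (\<forall>m. m \<oplus>\<^bsub>M\<^esub> \<zero>\<^bsub>M\<^esub> = m) \<and>
     (\<forall>m n. m \<oplus>\<^bsub>M\<^esub> (n \<oplus>\<^bsub>M\<^esub> \<one>\<^bsub>M\<^esub>) = (m \<oplus>\<^bsub>M\<^esub> n) \<oplus>\<^bsub>M\<^esub> \<one>\<^bsub>M\<^esub>) \<and>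
     (\<forall>m. m \<otimes>\<^bsub>M\<^esub> \<zero>\<^bsub>M\<^esub> = \<zero>\<^bsub>M\<^esub>) \<and>
     (\<forall>m n. m \<otimes>\<^bsub>M\<^esub> (n \<oplus>\<^bsub>M\<^esub> \<one>\<^bsub>M\<^esub>) = (m \<otimes>\<^bsub>M\<^esub> n) \<oplus>\<^bsub>M\<^esub> m) \<and>
     (\<forall>m. \<not> m \<sqsubset>\<^bsub>M\<^esub> \<zero>\<^bsub>M\<^esub>) \<and>
     (\<forall>m n. m \<sqsubset>\<^bsub>M\<^esub> n \<oplus>\<^bsub>M\<^esub> \<one>\<^bsub>M\<^esub> \<longleftrightarrow> m \<sqsubset>\<^bsub>M\<^esub> n \<or> m = n)"

definition sigma1_induction :: "('a, 'b) l2_structure_scheme \<Rightarrow> bool" where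
  "sigma1_induction M \<longleftrightarrow>
     (\<forall>\<phi> v e E. sigma1 \<phi> \<longrightarrow> range E \<subseteq> set_part M \<longrightarrow>
        sat M (e(v := \<zero>\<^bsub>M\<^esub>)) E \<phi> \<longrightarrow>
        (\<forall>n. sat M (e(v := n)) E \<phi> \<longrightarrow> sat M (e(v := n \<oplus>\<^bsub>M\<^esub> \<one>\<^bsub>M\<^esub>)) E \<phi>) \<longrightarrow>
        (\<forall>n. sat M (e(v := n)) E \<phi>))"

definition delta1_comprehension :: "('a, 'b) l2_structure_scheme \<Rightarrow> bool" where
  "delta1_comprehension M \<longleftrightarrow>
     (\<forall>\<phi> \<psi> v e E. sigma1 \<phi> \<longrightarrow> pi1 \<psi> \<longrightarrow> range E \<subseteq> set_part M \<longrightarrow>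
        (\<forall>n. sat M (e(v := n)) E \<phi> \<longleftrightarrow> sat M (e(v := n)) E \<psi>) \<longrightarrow>
        {n. sat M (e(v := n)) E \<phi>} \<in> set_part M)"

definition RCA0 :: "('a, 'b) l2_structure_scheme \<Rightarrow> bool" where
  "RCA0 M \<longleftrightarrow> set_part M \<noteq> {} \<and> basic_axioms M \<and> sigma1_induction M \<and> delta1_comprehension M"

section \<open>Coding inside a structure\<close>

text \<open>
  Pairs, finite sets and finite sequences are coded by numbers of the structure as in Simpson,
  \<^emph>\<open>Subsystems of Second Order Arithmetic\<close>, Section II.2.
\<close>

primrec num :: "('a, 'b) l2_structure_scheme \<Rightarrow> nat \<Rightarrow> 'a" where
  "num M 0 = \<zero>\<^bsub>M\<^esub>"
| "num M (Suc n) = num M n \<oplus>\<^bsub>M\<^esub> \<one>\<^bsub>M\<^esub>"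

definition below :: "('a, 'b) l2_structure_scheme \<Rightarrow> 'a \<Rightarrow> 'a set" where
  "below M a = {x. x \<sqsubset>\<^bsub>M\<^esub> a}"

definition minimum :: "('a, 'b) l2_structure_scheme \<Rightarrow> 'a set \<Rightarrow> 'a" where
  "minimum M A = (THE m. m \<in> A \<and> (\<forall>a\<in>A. m = a \<or> m \<sqsubset>\<^bsub>M\<^esub> a))"

definition pair :: "('a, 'b) l2_structure_scheme \<Rightarrow> 'a \<Rightarrow> 'a \<Rightarrow> 'a" where
  "pair M i j = (i \<oplus>\<^bsub>M\<^esub> j) \<otimes>\<^bsub>M\<^esub> (i \<oplus>\<^bsub>M\<^esub> j) \<oplus>\<^bsub>M\<^esub> i"

definition triple_codes :: "('a, 'b) l2_structure_scheme \<Rightarrow> 'a set" where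
  "triple_codes M = {c. \<exists>k m n. c = pair M k (pair M m n)}"

text \<open>
  The triple \<open>(k, m, n)\<close> represents the finite set of all \<open>i < k\<close> such that \<open>m(i + 1) + 1\<close>
  divides \<open>n\<close>.  The code of a finite set is the least triple representing it.
\<close>

definition elems :: "('a, 'b) l2_structure_scheme \<Rightarrow> 'a \<Rightarrow> 'a set" where
  "elems M c = {i. \<exists>k m n. c = pair M k (pair M m n) \<and> i \<sqsubset>\<^bsub>M\<^esub> k \<and>
     (\<exists>q. n = q \<otimes>\<^bsub>M\<^esub> (m \<otimes>\<^bsub>M\<^esub> (i \<oplus>\<^bsub>M\<^esub> \<one>\<^bsub>M\<^esub>) \<oplus>\<^bsub>M\<^esub> \<one>\<^bsub>M\<^esub>))}"

definition finset_codes :: "('a, 'b) l2_structure_scheme \<Rightarrow> 'a set" where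
  "finset_codes M =
     {c \<in> triple_codes M. \<forall>c'\<in>triple_codes M. c' \<sqsubset>\<^bsub>M\<^esub> c \<longrightarrow> elems M c' \<noteq> elems M c}"

definition seqs :: "('a, 'b) l2_structure_scheme \<Rightarrow> 'a set" where
  "seqs M = {s \<in> finset_codes M.
     (\<forall>x\<in>elems M s. \<exists>i j. x = pair M i j) \<and>
     (\<forall>i j j'. pair M i j \<in> elems M s \<longrightarrow> pair M i j' \<in> elems M s \<longrightarrow> j = j') \<and>
     (\<exists>l. \<forall>i. i \<sqsubset>\<^bsub>M\<^esub> l \<longleftrightarrow> (\<exists>j. pair M i j \<in> elems M s))}"

definition seq_len :: "('a, 'b) l2_structure_scheme \<Rightarrow> 'a \<Rightarrow> 'a" where
  "seq_len M s = (THE l. \<forall>i. i \<sqsubset>\<^bsub>M\<^esub> l \<longleftrightarrow> (\<exists>j. pair M i j \<in> elems M s))"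

definition seq_nth :: "('a, 'b) l2_structure_scheme \<Rightarrow> 'a \<Rightarrow> 'a \<Rightarrow> 'a" where
  "seq_nth M s i = (THE j. pair M i j \<in> elems M s)"

text \<open>
  A function \<open>A \<rightarrow> B\<close> of the structure is one whose graph belongs to the set sort; the values
  of \<open>f\<close> outside \<open>A\<close> are irrelevant.
\<close>

definition model_funs :: "('a, 'b) l2_structure_scheme \<Rightarrow> 'a set \<Rightarrow> 'a set \<Rightarrow> ('a \<Rightarrow> 'a) set" where
  "model_funs M A B = {f. f ` A \<subseteq> B \<and> {pair M i (f i) | i. i \<in> A} \<in> set_part M}"

text \<open>The \<open>n\<close>-th set of the sequence of sets coded by \<open>X\<close>.\<close>

definition row :: "('a, 'b) l2_structure_scheme \<Rightarrow> 'a set \<Rightarrow> 'a \<Rightarrow> 'a set" where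
  "row M X n = {x. pair M n x \<in> X}"

section \<open>Partitions\<close>

text \<open>
  \<open>A\<close> and \<open>B\<close> are initial segments, either \<^term>\<open>UNIV\<close> (for \<open>\<omega>\<close>) or
  \<^term>\<open>below M a\<close> (for the number \<open>a\<close>).
\<close>

definition ordered_surj ::
    "('a, 'b) l2_structure_scheme \<Rightarrow> 'a set \<Rightarrow> 'a set \<Rightarrow> ('a \<Rightarrow> 'a) \<Rightarrow> bool" where
  "ordered_surj M A B p \<longleftrightarrow> p ` A = B \<and>
     (\<forall>i\<in>B. \<forall>j\<in>B. i \<sqsubset>\<^bsub>M\<^esub> j \<longrightarrow>
        minimum M {a \<in> A. p a = i} \<sqsubset>\<^bsub>M\<^esub> minimum M {a \<in> A. p a = j})"

text \<open>$(\omega)^B$, for \<open>B\<close> an initial segment.\<close>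

definition partitions :: "('a, 'b) l2_structure_scheme \<Rightarrow> 'a set \<Rightarrow> ('a \<Rightarrow> 'a) set" where
  "partitions M B = {p \<in> model_funs M UNIV B. ordered_surj M UNIV B p}"

abbreviation k_partitions :: "('a, 'b) l2_structure_scheme \<Rightarrow> nat \<Rightarrow> ('a \<Rightarrow> 'a) set" where
  "k_partitions M k \<equiv> partitions M (below M (num M k))"

abbreviation omega_partitions :: "('a, 'b) l2_structure_scheme \<Rightarrow> ('a \<Rightarrow> 'a) set" where
  "omega_partitions M \<equiv> partitions M UNIV"

text \<open>$({<}\omega)^k$, as a set of codes of finite sequences.\<close>

definition strings :: "('a, 'b) l2_structure_scheme \<Rightarrow> nat \<Rightarrow> 'a set" where
  "strings M k =
     {s \<in> seqs M. ordered_surj M (below M (seq_len M s)) (below M (num M k)) (seq_nth M s)}"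

text \<open>$(p)^k$, for $p \in (\omega)^\omega$.\<close>

definition coarsenings ::
    "('a, 'b) l2_structure_scheme \<Rightarrow> ('a \<Rightarrow> 'a) \<Rightarrow> nat \<Rightarrow> ('a \<Rightarrow> 'a) set" where
  "coarsenings M p k = {x \<circ> p | x. x \<in> k_partitions M k}"

definition initial_seg :: "('a, 'b) l2_structure_scheme \<Rightarrow> 'a \<Rightarrow> ('a \<Rightarrow> 'a) \<Rightarrow> bool" where
  "initial_seg M s p \<longleftrightarrow> (\<forall>i. i \<sqsubset>\<^bsub>M\<^esub> seq_len M s \<longrightarrow> seq_nth M s i = p i)"

definition restriction :: "('a, 'b) l2_structure_scheme \<Rightarrow> ('a \<Rightarrow> 'a) \<Rightarrow> 'a \<Rightarrow> 'a" where
  "restriction M p m = (THE s. s \<in> seqs M \<and> seq_len M s = m \<and> initial_seg M s p)"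

definition block_min :: "('a, 'b) l2_structure_scheme \<Rightarrow> ('a \<Rightarrow> 'a) \<Rightarrow> 'a \<Rightarrow> 'a" where
  "block_min M p i = minimum M {a. p a = i}"

text \<open>$p^*$, for $p \in (\omega)^k$ and $k \ge 1$.\<close>

definition star :: "('a, 'b) l2_structure_scheme \<Rightarrow> nat \<Rightarrow> ('a \<Rightarrow> 'a) \<Rightarrow> 'a" where
  "star M k p = restriction M p (block_min M p (num M (k - 1)))"

section \<open>Open sets and colorings\<close>

definition cylinder :: "('a, 'b) l2_structure_scheme \<Rightarrow> nat \<Rightarrow> 'a \<Rightarrow> ('a \<Rightarrow> 'a) set" where
  "cylinder M k s = {p \<in> k_partitions M k. initial_seg M s p}"

definition open_code :: "('a, 'b) l2_structure_scheme \<Rightarrow> nat \<Rightarrow> 'a set \<Rightarrow> bool" where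
  "open_code M k U \<longleftrightarrow> U \<in> set_part M \<and> U \<subseteq> {pair M n s | n s. s \<in> strings M k}"

definition open_set :: "('a, 'b) l2_structure_scheme \<Rightarrow> nat \<Rightarrow> 'a set \<Rightarrow> ('a \<Rightarrow> 'a) set" where
  "open_set M k U = {p. \<exists>n s. s \<in> strings M k \<and> pair M n s \<in> U \<and> p \<in> cylinder M k s}"

definition is_dense :: "('a, 'b) l2_structure_scheme \<Rightarrow> nat \<Rightarrow> ('a \<Rightarrow> 'a) set \<Rightarrow> bool" where
  "is_dense M k P \<longleftrightarrow> (\<forall>t\<in>strings M k. cylinder M k t \<inter> P \<noteq> {})"

text \<open>
  In the following, \<open>U\<close> codes the finite sequence of open sets $\langle O_i\rangle_{i<\ell}$ and
  \<open>D\<close> codes the infinite sequence $\langle D_n\rangle_{n<\omega}$.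
\<close>

definition disjoint_open_seq ::
    "('a, 'b) l2_structure_scheme \<Rightarrow> nat \<Rightarrow> nat \<Rightarrow> 'a set \<Rightarrow> bool" where
  "disjoint_open_seq M k l U \<longleftrightarrow> U \<in> set_part M \<and>
     (\<forall>i\<in>below M (num M l). open_code M k (row M U i)) \<and>
     (\<forall>i\<in>below M (num M l). \<forall>j\<in>below M (num M l). i \<noteq> j \<longrightarrow>
        open_set M k (row M U i) \<inter> open_set M k (row M U j) = {})"

definition baire_coloring ::
    "('a, 'b) l2_structure_scheme \<Rightarrow> nat \<Rightarrow> nat \<Rightarrow> 'a set \<Rightarrow> 'a set \<Rightarrow> bool" where
  "baire_coloring M k l U D \<longleftrightarrow> disjoint_open_seq M k l U \<and>
     is_dense M k (\<Union>i\<in>below M (num M l). open_set M k (row M U i)) \<and>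
     D \<in> set_part M \<and>
     (\<forall>n. open_code M k (row M D n) \<and> is_dense M k (open_set M k (row M D n)))"

definition open_coloring ::
    "('a, 'b) l2_structure_scheme \<Rightarrow> nat \<Rightarrow> nat \<Rightarrow> 'a set \<Rightarrow> bool" where
  "open_coloring M k l U \<longleftrightarrow> disjoint_open_seq M k l U \<and>
     k_partitions M k = (\<Union>i\<in>below M (num M l). open_set M k (row M U i))"

section \<open>The dual Ramsey principles\<close>

definition Baire_DRT :: "('a, 'b) l2_structure_scheme \<Rightarrow> nat \<Rightarrow> nat \<Rightarrow> bool" where
  "Baire_DRT M k l \<longleftrightarrow>
     (\<forall>U D. baire_coloring M k l U D \<longrightarrow>
        (\<exists>p\<in>omega_partitions M. \<exists>i\<in>below M (num M l). \<forall>x\<in>coarsenings M p k.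
           x \<in> open_set M k (row M U i) \<inter> (\<Inter>n. open_set M k (row M D n))))"

definition ODRT :: "('a, 'b) l2_structure_scheme \<Rightarrow> nat \<Rightarrow> nat \<Rightarrow> bool" where
  "ODRT M k l \<longleftrightarrow>
     (\<forall>U. open_coloring M k l U \<longrightarrow>
        (\<exists>p\<in>omega_partitions M. \<exists>i\<in>below M (num M l). \<forall>x\<in>coarsenings M p k.
           x \<in> open_set M k (row M U i)))"

definition CDRT :: "('a, 'b) l2_structure_scheme \<Rightarrow> nat \<Rightarrow> nat \<Rightarrow> bool" where
  "CDRT M k l \<longleftrightarrow>
     (\<forall>c\<in>model_funs M (strings M (k - 1)) (below M (num M l)).
        \<exists>p\<in>omega_partitions M. \<exists>i\<in>below M (num M l). \<forall>x\<in>coarsenings M p k.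
           c (star M k x) = i)"

end

theory Submission
  imports Defs
begin

text \<open>
  The implications from Baire colorings to open colorings and on to colorings of strings are
  direct: an open coloring is a Baire coloring, and \<open>p \<mapsto> c(p\<^sup>*)\<close> is an open coloring because
  \<open>p\<^sup>*\<close> can be read off an initial segment of \<open>p\<close>.  For the converse, build \<open>y \<in> (\<omega>)\<^sup>\<omega>\<close> in stages.
  At stage \<open>m\<close> open the block \<open>m\<close> and then extend within the blocks \<open>0, \<dots>, m\<close> until, for
  each of the finitely many \<open>x \<in> (m + 1)\<^sup>k\<close>, the string \<open>x \<circ> y\<close> built so far forces some \<open>O\<^sub>i\<close>
  and all \<open>D\<^sub>n\<close> with \<open>n < m\<close>.  If \<open>q\<close> is a partition of \<open>\<omega>\<close> into \<open>k\<close> blocks whose last block starts at \<open>m\<close>,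
  then the color of \<open>q \<circ> y\<close> is already decided at stage \<open>m\<close>, hence depends only on \<open>q\<^sup>*\<close>.
  A homogeneous \<open>p\<close> for the induced coloring of strings gives the solution \<open>p \<circ> y\<close>.
  To do this inside an arbitrary model of $\mathsf{RCA}_0$, the set sort is treated as
  a class of recursive sets closed under bounded quantification, minimization and primitive
  recursion.
\<close>

section \<open>Arithmetic in a model\<close>

text \<open>Density produces a partition of \<omega> into \<open>k\<close> blocks, not an extension
  of \<open>y\<close>. Since \<open>x\<close> maps the blocks \<open>0, ..., m\<close> onto
  \<open>k\<close>, every value of that partition lifts through \<open>x\<close> to a block of
  \<open>y\<close> that is already open, so \<open>y\<close> can follow the partition as far as
  necessary without opening a new block. Strings are only ever lengthened, so a requirement once met
  stays met. A partition into \<open>k\<close> blocks whose last block starts at \<open>m\<close>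
  has restrictions to \<open>m + 1, m + 2, ...\<close> that are all onto \<open>k\<close>. It is
  therefore treated at every stage from \<open>m\<close> on, and so meets each \<open>D n\<close>,
  although its color is already fixed at stage \<open>m\<close>. The model offers only \<Sigma>1
  induction and \<Delta>1 comprehension. The claim that all \<open>x\<close> have been treated is
  kept recursive by an explicit bound on the codes of strings of given length and by a single number
  bounding all witnesses. Choices are replaced by least witnesses, which makes the stage function
  recursive and total.\<close>

lemmas [simp] = bounded_fm.intros(1-5)

locale rca0 =
  fixes M :: "('a, 'b) l2_structure_scheme" (structure)
  assumes RCA0: "RCA0 M"
begin

section \<open>Ordered semiring laws from \<Sigma>1 induction\<close>

lemma
  shows succ_ne [simp]: "n \<oplus> \<one> \<noteq> \<zero>"
    and succ_inj: "m \<oplus> \<one> = n \<oplus> \<one> \<Longrightarrow> m = n"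
    and add_zero [simp]: "m \<oplus> \<zero> = m"
    and add_succ: "m \<oplus> (n \<oplus> \<one>) = (m \<oplus> n) \<oplus> \<one>"
    and mul_zero [simp]: "m \<otimes> \<zero> = \<zero>"
    and mul_succ: "m \<otimes> (n \<oplus> \<one>) = (m \<otimes> n) \<oplus> m"
    and not_lt_zero [simp]: "\<not> m \<sqsubset> \<zero>"
    and lt_succ: "m \<sqsubset> n \<oplus> \<one> \<longleftrightarrow> m \<sqsubset> n \<or> m = n"
  using RCA0 unfolding RCA0_def basic_axioms_def by blast+

text \<open>Confines syntax to one formula per application: number variable 0 is the induction
  variable, variable 1 the existential witness, and higher variables carry parameters.
  \<open>delta1_fm\<close> follows the same convention.\<close>

lemma sigma1_induct_fm:
  assumes "bounded_fm \<phi>" "range E \<subseteq> set_part M"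
    and "\<And>n. (\<exists>a. sat M (e(0 := n, 1 := a)) E \<phi>) \<longleftrightarrow> P n"
    and "P \<zero>" "\<And>n. P n \<Longrightarrow> P (n \<oplus> \<one>)"
  shows "P n"
proof -
  have "sigma1 (Ex 1 \<phi>)"
    using assms(1) by (auto simp: sigma1_def)
  moreover have "sigma1_induction M"
    using RCA0 by (simp add: RCA0_def)
  moreover have *: "sat M (e(0 := n)) E (Ex 1 \<phi>) \<longleftrightarrow> P n" for n
    using assms(3) by simp
  ultimately have "sat M (e(0 := n)) E (Ex 1 \<phi>)"
    unfolding sigma1_induction_def using assms(2,4,5) by meson
  then show ?thesis
    using * by simp
qed

text \<open>A dummy valuation for formulas without set variables, since the axiom schemes ask that
  every set variable denote a set of the model.\<close>

definition some_sets :: "nat \<Rightarrow> 'a set" where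
  "some_sets _ = (SOME X. X \<in> set_part M)"

lemma range_some_sets: "range some_sets \<subseteq> set_part M"
  using RCA0 by (auto simp: some_sets_def RCA0_def some_in_eq)

text \<open>Variables 2 and 3 hold the parameters \<open>a\<close> and \<open>b\<close>. A formula
  not mentioning variable 1 becomes \<Sigma>1 through a vacuous quantifier.\<close>

lemmas open_induct = sigma1_induct_fm[OF _ range_some_sets, where e = "(\<lambda>_. \<zero>)(2 := a, 3 := b)" for a b]

lemma add_assoc: "(a \<oplus> b) \<oplus> n = a \<oplus> (b \<oplus> n)"
  by (rule open_induct[where a = a and b = b and P = "\<lambda>n. (a \<oplus> b) \<oplus> n = a \<oplus> (b \<oplus> n)" and
        \<phi> = "Eq (Plus (Plus (Var 2) (Var 3)) (Var 0)) (Plus (Var 2) (Plus (Var 3) (Var 0)))"])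
    (simp_all add: add_succ)

lemma zero_add [simp]: "\<zero> \<oplus> n = n"
  by (rule open_induct[where P = "\<lambda>n. \<zero> \<oplus> n = n" and \<phi> = "Eq (Plus Zero (Var 0)) (Var 0)"])
    (simp_all flip: add_assoc)

lemma one_add: "\<one> \<oplus> n = n \<oplus> \<one>"
  by (rule open_induct[where P = "\<lambda>n. \<one> \<oplus> n = n \<oplus> \<one>" and
        \<phi> = "Eq (Plus One (Var 0)) (Plus (Var 0) One)"])
    (simp_all flip: add_assoc)

lemma add_commute: "a \<oplus> n = n \<oplus> a"
proof (rule open_induct[where a = a and P = "\<lambda>n. a \<oplus> n = n \<oplus> a" and
        \<phi> = "Eq (Plus (Var 2) (Var 0)) (Plus (Var 0) (Var 2))"])
  fix n assume "a \<oplus> n = n \<oplus> a"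
  then show "a \<oplus> (n \<oplus> \<one>) = n \<oplus> \<one> \<oplus> a"
    by (metis add_assoc one_add)
qed simp_all

lemma distrib_left: "a \<otimes> (b \<oplus> n) = a \<otimes> b \<oplus> a \<otimes> n"
proof (rule open_induct[where a = a and b = b and P = "\<lambda>n. a \<otimes> (b \<oplus> n) = a \<otimes> b \<oplus> a \<otimes> n" and
        \<phi> = "Eq (Times (Var 2) (Plus (Var 3) (Var 0)))
          (Plus (Times (Var 2) (Var 3)) (Times (Var 2) (Var 0)))"])
  fix n assume "a \<otimes> (b \<oplus> n) = a \<otimes> b \<oplus> a \<otimes> n"
  then show "a \<otimes> (b \<oplus> (n \<oplus> \<one>)) = a \<otimes> b \<oplus> a \<otimes> (n \<oplus> \<one>)"
    by (metis add_assoc add_succ mul_succ)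
qed simp_all

lemma mul_one [simp]: "a \<otimes> \<one> = a"
  using mul_succ[of a \<zero>] by simp

lemma mul_assoc: "(a \<otimes> b) \<otimes> n = a \<otimes> (b \<otimes> n)"
proof (rule open_induct[where a = a and b = b and P = "\<lambda>n. (a \<otimes> b) \<otimes> n = a \<otimes> (b \<otimes> n)" and
        \<phi> = "Eq (Times (Times (Var 2) (Var 3)) (Var 0)) (Times (Var 2) (Times (Var 3) (Var 0)))"])
  fix n assume "(a \<otimes> b) \<otimes> n = a \<otimes> (b \<otimes> n)"
  then show "(a \<otimes> b) \<otimes> (n \<oplus> \<one>) = a \<otimes> (b \<otimes> (n \<oplus> \<one>))"
    by (simp add: distrib_left)
qed simp_all

lemma zero_mul [simp]: "\<zero> \<otimes> n = \<zero>"
  by (rule open_induct[where P = "\<lambda>n. \<zero> \<otimes> n = \<zero>" and \<phi> = "Eq (Times Zero (Var 0)) Zero"])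
    (simp_all add: mul_succ)

lemma one_mul [simp]: "\<one> \<otimes> n = n"
  by (rule open_induct[where P = "\<lambda>n. \<one> \<otimes> n = n" and \<phi> = "Eq (Times One (Var 0)) (Var 0)"])
    (simp_all add: mul_succ)

lemma add_left_commute: "a \<oplus> (b \<oplus> c) = b \<oplus> (a \<oplus> c)"
  using add_assoc[of a b c] add_assoc[of b a c] add_commute[of a b] by simp

lemma distrib_right: "(a \<oplus> b) \<otimes> n = a \<otimes> n \<oplus> b \<otimes> n"
  by (rule open_induct[where a = a and b = b and P = "\<lambda>n. (a \<oplus> b) \<otimes> n = a \<otimes> n \<oplus> b \<otimes> n" and
        \<phi> = "Eq (Times (Plus (Var 2) (Var 3)) (Var 0))
          (Plus (Times (Var 2) (Var 0)) (Times (Var 3) (Var 0)))"])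
    (simp_all add: mul_succ add_assoc add_commute add_left_commute)

lemma mul_commute: "a \<otimes> n = n \<otimes> a"
  by (rule open_induct[where a = a and P = "\<lambda>n. a \<otimes> n = n \<otimes> a" and
        \<phi> = "Eq (Times (Var 2) (Var 0)) (Times (Var 0) (Var 2))"])
    (simp_all add: mul_succ distrib_right)

lemma add_right_cancel: "a \<oplus> n = b \<oplus> n \<Longrightarrow> a = b"
proof -
  have "a \<oplus> n = b \<oplus> n \<longrightarrow> a = b"
    by (rule open_induct[where a = a and b = b and P = "\<lambda>n. a \<oplus> n = b \<oplus> n \<longrightarrow> a = b" and
          \<phi> = "Neg (Conj (Eq (Plus (Var 2) (Var 0)) (Plus (Var 3) (Var 0))) (Neg (Eq (Var 2) (Var 3))))"])
      (auto simp flip: add_assoc dest: succ_inj)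
  then show "a \<oplus> n = b \<oplus> n \<Longrightarrow> a = b" by simp
qed

lemma lt_imp_ex: "m \<sqsubset> n \<Longrightarrow> \<exists>d. n = m \<oplus> (d \<oplus> \<one>)"
proof -
  \<comment> \<open>Pulling the quantifier over \<open>d\<close> out of the implication gives the
    induction statement the \<Sigma>1 shape, with \<open>d\<close> as variable 1.\<close>
  have "\<exists>d. m \<sqsubset> n \<longrightarrow> n = m \<oplus> (d \<oplus> \<one>)"
  proof (rule open_induct[where a = m and P = "\<lambda>n. \<exists>d. m \<sqsubset> n \<longrightarrow> n = m \<oplus> (d \<oplus> \<one>)" and
          \<phi> = "Neg (Conj (Less (Var 2) (Var 0)) (Neg (Eq (Var 0) (Plus (Var 2) (Plus (Var 1) One)))))"])
    fix n assume "\<exists>d. m \<sqsubset> n \<longrightarrow> n = m \<oplus> (d \<oplus> \<one>)"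
    then obtain d where d: "m \<sqsubset> n \<Longrightarrow> n \<oplus> \<one> = m \<oplus> (d \<oplus> \<one> \<oplus> \<one>)"
      using add_succ by auto
    show "\<exists>d. m \<sqsubset> n \<oplus> \<one> \<longrightarrow> n \<oplus> \<one> = m \<oplus> (d \<oplus> \<one>)"
    proof (cases "m \<sqsubset> n")
      case False
      then show ?thesis
        using lt_succ by (intro exI[of _ \<zero>]) auto
    qed (use d in blast)
  qed auto
  then show "m \<sqsubset> n \<Longrightarrow> \<exists>d. n = m \<oplus> (d \<oplus> \<one>)" by blast
qed

lemma lt_add_succ: "m \<sqsubset> m \<oplus> (n \<oplus> \<one>)"
  by (rule open_induct[where a = m and P = "\<lambda>n. m \<sqsubset> m \<oplus> (n \<oplus> \<one>)" and
          \<phi> = "Less (Var 2) (Plus (Var 2) (Plus (Var 0) One))"])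
   (simp_all add: lt_succ flip: add_assoc)

lemma lt_iff: "m \<sqsubset> n \<longleftrightarrow> (\<exists>d. n = m \<oplus> (d \<oplus> \<one>))"
  using lt_imp_ex lt_add_succ by blast

lemma lt_irrefl: "\<not> n \<sqsubset> n"
proof
  assume "n \<sqsubset> n"
  then obtain d where "n = (d \<oplus> \<one>) \<oplus> n"
    using lt_iff add_commute by metis
  then show False
    using add_right_cancel[of \<zero> n "d \<oplus> \<one>"] succ_ne[of d] by simp
qed

lemma lt_trans: "a \<sqsubset> b \<Longrightarrow> b \<sqsubset> c \<Longrightarrow> a \<sqsubset> c"
  unfolding lt_iff by (metis add_assoc)

lemma zero_or_succ: "n = \<zero> \<or> (\<exists>d. n = d \<oplus> \<one>)"
proof -
  have "\<exists>d. n = \<zero> \<or> n = d \<oplus> \<one>"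
    by (rule open_induct[where P = "\<lambda>n. \<exists>d. n = \<zero> \<or> n = d \<oplus> \<one>" and
          \<phi> = "Neg (Conj (Neg (Eq (Var 0) Zero)) (Neg (Eq (Var 0) (Plus (Var 1) One))))"]) auto
  then show ?thesis by blast
qed

lemma lt_linear: "m \<sqsubset> n \<or> m = n \<or> n \<sqsubset> m"
proof (rule open_induct[where a = m and P = "\<lambda>n. m \<sqsubset> n \<or> m = n \<or> n \<sqsubset> m" and
          \<phi> = "Neg (Conj (Neg (Less (Var 2) (Var 0))) (Conj (Neg (Eq (Var 2) (Var 0))) (Neg (Less (Var 0) (Var 2)))))"])
  show "m \<sqsubset> \<zero> \<or> m = \<zero> \<or> \<zero> \<sqsubset> m"
    using lt_add_succ[of \<zero>] zero_or_succ[of m] by auto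
  fix n assume "m \<sqsubset> n \<or> m = n \<or> n \<sqsubset> m"
  moreover have "m = n \<oplus> \<one> \<or> n \<oplus> \<one> \<sqsubset> m" if lt: "n \<sqsubset> m"
  proof -
    obtain d where d: "m = n \<oplus> (d \<oplus> \<one>)"
      using lt lt_iff by blast
    show ?thesis
    proof (cases "d = \<zero>")
      case False
      then obtain e where "d = e \<oplus> \<one>"
        using zero_or_succ by blast
      then have "m = n \<oplus> \<one> \<oplus> (e \<oplus> \<one>)"
        using d one_add[of "e \<oplus> \<one>"] by (simp add: add_assoc)
      then show ?thesis
        using lt_add_succ by simp
    qed (simp add: d)
  qed
  ultimately show "m \<sqsubset> n \<oplus> \<one> \<or> m = n \<oplus> \<one> \<or> n \<oplus> \<one> \<sqsubset> m"
    using lt_succ by blast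
qed auto

definition leq (infix "\<sqsubseteq>" 50) where "m \<sqsubseteq> n \<longleftrightarrow> m \<sqsubset> n \<or> m = n"

text \<open>Truncated subtraction, serving as the minus of the class
  \<open>linordered_semidom\<close> interpreted below.\<close>

definition monus (infixl "\<ominus>" 65) where
  "m \<ominus> n = (if n \<sqsubseteq> m then THE d. m = n \<oplus> d else \<zero>)"

lemma leq_iff: "m \<sqsubseteq> n \<longleftrightarrow> (\<exists>d. n = m \<oplus> d)"
proof
  assume "m \<sqsubseteq> n"
  then show "\<exists>d. n = m \<oplus> d"
    unfolding leq_def lt_iff by (auto intro: exI[of _ \<zero>])
next
  assume "\<exists>d. n = m \<oplus> d"
  then obtain d where "n = m \<oplus> d" by blast
  then show "m \<sqsubseteq> n"
    using zero_or_succ[of d] by (auto simp: leq_def lt_add_succ)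
qed

lemma add_left_cancel: "n \<oplus> a = n \<oplus> b \<Longrightarrow> a = b"
  using add_right_cancel[of a n b] add_commute[of n] by simp

lemma add_monus: "(m \<oplus> n) \<ominus> m = n"
proof -
  have "m \<sqsubseteq> m \<oplus> n"
    using leq_iff by blast
  then show ?thesis
    unfolding monus_def by (auto dest: add_left_cancel)
qed

lemma leq_linear: "m \<sqsubseteq> n \<or> n \<sqsubseteq> m"
  using lt_linear leq_def by blast

lemma leq_antisym: "m \<sqsubseteq> n \<Longrightarrow> n \<sqsubseteq> m \<Longrightarrow> m = n"
  using lt_irrefl lt_trans leq_def by blast

lemma monus_eq_zero: "m \<sqsubseteq> n \<Longrightarrow> m \<ominus> n = \<zero>"
  using leq_antisym[of m n] add_monus[of n \<zero>] by (cases "n \<sqsubseteq> m") (auto simp: monus_def)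

lemma leqE:
  assumes "m \<sqsubseteq> n" obtains d where "n = m \<oplus> d"
  using assms leq_iff by blast

lemma leq_trans: "a \<sqsubseteq> b \<Longrightarrow> b \<sqsubseteq> c \<Longrightarrow> a \<sqsubseteq> c"
  using lt_trans leq_def by blast

text \<open>Makes the library facts on order, cancellation and divisibility available, under the
  prefix \<open>N\<close>, for the operations of an arbitrary model.\<close>

sublocale N: linordered_semidom where plus = "(\<oplus>)" and zero = "\<zero>" and one = "\<one>"
  and times = "(\<otimes>)" and less_eq = "(\<sqsubseteq>)" and less = "(\<sqsubset>)" and minus = "(\<ominus>)"
proof
  fix a b c :: 'a
  show "\<zero> \<noteq> \<one>"
    by (metis succ_ne zero_add)
  show "a \<otimes> b \<otimes> c = a \<otimes> (b \<otimes> c)" "a \<oplus> b \<oplus> c = a \<oplus> (b \<oplus> c)"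
    "a \<otimes> b = b \<otimes> a" "a \<oplus> b = b \<oplus> a" "(a \<oplus> b) \<otimes> c = a \<otimes> c \<oplus> b \<otimes> c"
    by (rule mul_assoc add_assoc mul_commute add_commute distrib_right)+
  show "a \<oplus> b \<ominus> a = b"
    by (fact add_monus)
  have zero_monus: "\<zero> \<ominus> x = \<zero>" for x
    using leq_iff[of \<zero> x] by (intro monus_eq_zero) auto
  show "a \<ominus> b \<ominus> c = a \<ominus> (b \<oplus> c)"
  proof (cases "a \<sqsubseteq> b")
    case True
    then have "a \<sqsubseteq> b \<oplus> c"
      using leq_iff leq_trans by blast
    then show ?thesis
      using True by (simp add: monus_eq_zero zero_monus)
  next
    case False
    then obtain d where d: "a = b \<oplus> d"
      using leq_linear leqE by metis
    show ?thesis
    proof (cases "d \<sqsubseteq> c")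
      case True
      then have "a \<sqsubseteq> b \<oplus> c"
        using d leq_iff by (auto simp: add_assoc)
      then show ?thesis using True d by (simp add: monus_eq_zero add_monus)
    next
      case False
      then obtain d' where "d = c \<oplus> d'"
        using leq_linear leqE by metis
      then show ?thesis using d add_monus[of b d] add_monus[of c d'] add_monus[of "b \<oplus> c" d'] by (simp add: add_assoc)
    qed
  qed
  show "c \<otimes> (a \<ominus> b) = c \<otimes> a \<ominus> c \<otimes> b"
  proof (cases "a \<sqsubseteq> b")
    case True
    then have "c \<otimes> a \<sqsubseteq> c \<otimes> b"
      unfolding leq_iff by (auto simp: distrib_left)
    then show ?thesis using True by (simp add: monus_eq_zero)
  next
    case False
    then obtain d where "a = b \<oplus> d"
      using leq_linear leqE by metis
    then show ?thesis
      by (simp add: add_monus distrib_left)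
  qed
  show "a \<sqsubseteq> a"
    by (simp add: leq_def)
  show "a \<otimes> b \<noteq> \<zero>" if "a \<noteq> \<zero>" "b \<noteq> \<zero>"
    using that zero_or_succ[of a] zero_or_succ[of b] by (auto simp: mul_succ simp flip: add_assoc)
  show "(a \<sqsubset> b) \<longleftrightarrow> (a \<sqsubseteq> b \<and> \<not> b \<sqsubseteq> a)"
    using leq_def lt_irrefl lt_trans by blast
  show "a \<sqsubseteq> b \<Longrightarrow> b \<sqsubseteq> c \<Longrightarrow> a \<sqsubseteq> c" "a \<sqsubseteq> b \<Longrightarrow> b \<sqsubseteq> a \<Longrightarrow> a = b" "a \<sqsubseteq> b \<or> b \<sqsubseteq> a"
    using leq_trans leq_antisym leq_linear by blast+
  show "a \<sqsubseteq> b \<Longrightarrow> c \<oplus> a \<sqsubseteq> c \<oplus> b"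
    unfolding leq_iff by (auto simp: add_assoc)
  show "c \<otimes> a \<sqsubset> c \<otimes> b" if less: "a \<sqsubset> b" "\<zero> \<sqsubset> c"
  proof -
    obtain d e where "b = a \<oplus> (d \<oplus> \<one>)" "c = e \<oplus> \<one>"
      using less unfolding lt_iff zero_add by metis
    then have "c \<otimes> b = c \<otimes> a \<oplus> (c \<otimes> d \<oplus> e \<oplus> \<one>)"
      by (simp add: distrib_left mul_succ add_assoc)
    then show ?thesis
      using lt_add_succ by simp
  qed
  show "\<zero> \<sqsubset> \<one>"
    using lt_add_succ[of \<zero> \<zero>] by simp
  show "b \<sqsubseteq> a \<Longrightarrow> a \<ominus> b \<oplus> b = a"
    by (auto elim!: leqE simp: add_monus intro: add_commute)
qed (rule zero_add zero_mul mul_zero one_mul distrib_left)+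
end

section \<open>Recursive sets and functions of a model\<close>

context rca0
begin

lemma num_pos: "k > 0 \<Longrightarrow> num M k = num M (k - 1) \<oplus> \<one>"
  by (cases k) auto

section \<open>Pairing and projections\<close>

abbreviation pr :: "'a \<Rightarrow> 'a \<Rightarrow> 'a" where "pr \<equiv> pair M"

lemma less_succ_iff: "a \<sqsubset> b \<oplus> \<one> \<longleftrightarrow> a \<sqsubseteq> b"
  by (simp add: leq_def lt_succ)

lemma succ_leq_iff: "a \<oplus> \<one> \<sqsubseteq> b \<longleftrightarrow> a \<sqsubset> b"
  by (metis N.leD N.leI N.less_le_not_le less_succ_iff)

lemma zero_leq [simp]: "\<zero> \<sqsubseteq> a"
  by (simp add: leq_iff)

lemma zero_lt_iff: "\<zero> \<sqsubset> a \<longleftrightarrow> a \<noteq> \<zero>"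
  using zero_leq[of a] N.less_irrefl by (auto simp: leq_def)

text \<open>With \<open>a\<close> the smaller sum, the next square is
  \<open>a * a + a + (a + 1)\<close>, which exceeds \<open>a * a + i\<close> because
  \<open>i \<le> a\<close>. Hence the code determines the sum, and then its components.\<close>

lemma pr_mono_sum:
  assumes "i \<oplus> j \<sqsubset> i' \<oplus> j'" shows "pr i j \<sqsubset> pr i' j'"
proof -
  define a where "a = i \<oplus> j"
  define b where "b = i' \<oplus> j'"
  have "a \<oplus> \<one> \<sqsubseteq> b"
    using assms by (simp add: a_def b_def succ_leq_iff)
  then have "(a \<oplus> \<one>) \<otimes> (a \<oplus> \<one>) \<sqsubseteq> b \<otimes> b"
    by (simp add: N.mult_mono)
  moreover have "(a \<oplus> \<one>) \<otimes> (a \<oplus> \<one>) = a \<otimes> a \<oplus> a \<oplus> (a \<oplus> \<one>)"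
    by (simp add: distrib_left distrib_right add_assoc)
  moreover have "a \<otimes> a \<oplus> i \<sqsubset> a \<otimes> a \<oplus> a \<oplus> (a \<oplus> \<one>)"
  proof -
    have "i \<sqsubseteq> a" by (simp add: a_def)
    then have "i \<sqsubset> a \<oplus> (a \<oplus> \<one>)" using lt_add_succ N.le_less_trans by blast
    then show ?thesis by (simp add: add_assoc)
  qed
  moreover have "b \<otimes> b \<sqsubseteq> b \<otimes> b \<oplus> i'" by simp
  ultimately show ?thesis
    unfolding pair_def a_def[symmetric] b_def[symmetric] by order
qed

lemma pr_inject [simp]: "pr i j = pr i' j' \<longleftrightarrow> i = i' \<and> j = j'"
proof
  assume "pr i j = pr i' j'"
  then have "i \<oplus> j = i' \<oplus> j'"
    using pr_mono_sum N.less_linear N.less_irrefl by metis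
  with \<open>pr i j = pr i' j'\<close> show "i = i' \<and> j = j'"
    unfolding pair_def by (metis N.add_left_cancel)
qed simp

lemma leq_square: "a \<sqsubseteq> a \<otimes> a"
proof (cases "a = \<zero>")
  case False
  then have "\<one> \<sqsubseteq> a"
    using succ_leq_iff[of \<zero>] by (simp add: zero_lt_iff)
  then have "\<one> \<otimes> a \<sqsubseteq> a \<otimes> a"
    by (intro N.mult_right_mono) auto
  then show ?thesis by simp
qed simp

lemma leq_pr1 [simp]: "i \<sqsubseteq> pr i j" and leq_pr2 [simp]: "j \<sqsubseteq> pr i j"
proof -
  show "i \<sqsubseteq> pr i j" by (simp add: pair_def)
  have "j \<sqsubseteq> i \<oplus> j" by simp
  then show "j \<sqsubseteq> pr i j"
    using leq_square[of "i \<oplus> j"] by (metis N.add_increasing2 N.order_trans pair_def zero_leq)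
qed

lemma pr_mono: "i \<sqsubseteq> i' \<Longrightarrow> j \<sqsubseteq> j' \<Longrightarrow> pr i j \<sqsubseteq> pr i' j'"
  unfolding pair_def by (intro N.add_mono N.mult_mono) auto

text \<open>The pairing is not onto, so numbers that code no pair receive the default zero, which
  keeps both projections total and bounded by their argument.\<close>

definition pfst :: "'a \<Rightarrow> 'a" where
  "pfst z = (if \<exists>i j. z = pr i j then THE i. \<exists>j. z = pr i j else \<zero>)"
definition psnd :: "'a \<Rightarrow> 'a" where
  "psnd z = (if \<exists>i j. z = pr i j then THE j. \<exists>i. z = pr i j else \<zero>)"

lemma pfst_pr [simp]: "pfst (pr i j) = i" and psnd_pr [simp]: "psnd (pr i j) = j"
  by (auto simp: pfst_def psnd_def)

lemma pfst_leq: "pfst z \<sqsubseteq> z" and psnd_leq: "psnd z \<sqsubseteq> z"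
proof -
  have "pfst z \<sqsubseteq> z \<and> psnd z \<sqsubseteq> z"
  proof (cases "\<exists>i j. z = pr i j")
    case False
    then have "pfst z = \<zero>" "psnd z = \<zero>" by (auto simp: pfst_def psnd_def)
    then show ?thesis by simp
  qed auto
  then show "pfst z \<sqsubseteq> z" "psnd z \<sqsubseteq> z" by auto
qed

section \<open>Recursive predicates and functions\<close>

definition recp :: "('a \<Rightarrow> bool) \<Rightarrow> bool" where "recp P \<longleftrightarrow> {x. P x} \<in> set_part M"
definition recf :: "('a \<Rightarrow> 'a) \<Rightarrow> bool" where "recf f \<longleftrightarrow> {pr x (f x) | x. True} \<in> set_part M"

abbreviation (input) pairt :: "trm \<Rightarrow> trm \<Rightarrow> trm" where
  "pairt s t \<equiv> Plus (Times (Plus s t) (Plus s t)) s"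

lemma tval_pairt: "tval M e (pairt s t) = pr (tval M e s) (tval M e t)"
  by (simp add: pair_def)

definition exb :: "nat \<Rightarrow> trm \<Rightarrow> fm \<Rightarrow> fm" where
  "exb v t \<phi> = Ex v (Conj (Less (Var v) (Plus t One)) \<phi>)"

lemma sat_exb: "sat M e E (exb v t \<phi>) \<longleftrightarrow> (\<exists>a. a \<sqsubseteq> tval M (e(v := a)) t \<and> sat M (e(v := a)) E \<phi>)"
  by (simp add: exb_def less_succ_iff)

lemma bounded_exb: "bounded_fm \<phi> \<Longrightarrow> v \<notin> tvars t \<Longrightarrow> bounded_fm (exb v t \<phi>)"
  unfolding exb_def by (intro bounded_fm.intros) auto

lemma delta1_fm:
  assumes "bounded_fm \<phi>" "bounded_fm \<psi>" "range E \<subseteq> set_part M"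
    and "\<And>x. (\<exists>a. sat M (e(0 := x, 1 := a)) E \<phi>) \<longleftrightarrow> P x"
    and "\<And>x. (\<forall>a. sat M (e(0 := x, 1 := a)) E \<psi>) \<longleftrightarrow> P x"
  shows "recp P"
proof -
  have "sigma1 (Ex 1 \<phi>)" "pi1 (All 1 \<psi>)"
    using assms(1,2) by (auto simp: sigma1_def pi1_def)
  moreover have *: "sat M (e(0 := x)) E (Ex 1 \<phi>) \<longleftrightarrow> P x" "sat M (e(0 := x)) E (All 1 \<psi>) \<longleftrightarrow> P x" for x
    using assms(4,5) by simp_all
  moreover have "delta1_comprehension M"
    using RCA0 by (simp add: RCA0_def)
  ultimately have "{x. sat M (e(0 := x)) E (Ex 1 \<phi>)} \<in> set_part M"
    unfolding delta1_comprehension_def using assms(3) by meson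
  then show ?thesis
    using * by (simp add: recp_def)
qed

lemma bounded_fm_recp:
  assumes "bounded_fm \<phi>" "range E \<subseteq> set_part M"
    and "\<And>x a. sat M (e(0 := x, 1 := a)) E \<phi> \<longleftrightarrow> P x"
  shows "recp P"
  by (rule delta1_fm[OF assms(1) assms(1,2), where e = e]) (simp_all add: assms(3) del: One_nat_def)

definition sets2 :: "'a set \<Rightarrow> 'a set \<Rightarrow> nat \<Rightarrow> 'a set" where
  "sets2 A B n = (if n = 0 then A else B)"

lemma sets2 [simp]: "sets2 A B 0 = A" "sets2 A B (Suc n) = B"
  by (simp_all add: sets2_def)

lemma range_sets2: "A \<in> set_part M \<Longrightarrow> B \<in> set_part M \<Longrightarrow> range (sets2 A B) \<subseteq> set_part M"
  by (auto simp: sets2_def)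

lemma recp_not:
  assumes "recp P" shows "recp (\<lambda>x. \<not> P x)"
  using assms bounded_fm_recp[of "Neg (Mem (Var 0) 0)" "\<lambda>_. {x. P x}"]
  unfolding recp_def by auto

lemma recp_conj:
  assumes "recp P" "recp Q" shows "recp (\<lambda>x. P x \<and> Q x)"
  using assms bounded_fm_recp[of "Conj (Mem (Var 0) 0) (Mem (Var 0) 1)", OF _ range_sets2[of "{x. P x}" "{x. Q x}"]]
  unfolding recp_def by simp

text \<open>No term bounds \<open>f x\<close>, so this is genuine \<Delta>1 comprehension:
  \<open>P (f x)\<close> holds iff some \<open>v\<close> with \<open>(x, v)\<close> in the graph
  satisfies \<open>P\<close>, iff all such \<open>v\<close> do.\<close>

lemma recp_comp:
  assumes "recp P" "recf f" shows "recp (\<lambda>x. P (f x))"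
  by (rule delta1_fm[of "Conj (Mem (pairt (Var 0) (Var 1)) 0) (Mem (Var 1) 1)"
        "Neg (Conj (Mem (pairt (Var 0) (Var 1)) 0) (Neg (Mem (Var 1) 1)))" "sets2 {pr x (f x) | x. True} {x. P x}"])
    (use assms in \<open>auto simp: range_sets2 recp_def recf_def tval_pairt simp del: tval.simps(4,5)\<close>)


text \<open>Both components of a pair are at most the pair, so membership in the graph is a bounded
  statement once \<open>v = f x\<close> is.\<close>

lemma recf_fm:
  assumes "bounded_fm \<phi>" "range E \<subseteq> set_part M"
    and "\<And>z a x v. sat M (e(0 := z, 1 := a, 2 := x, 3 := v)) E \<phi> \<longleftrightarrow> v = f x"
  shows "recf f"
proof -
  have "recp (\<lambda>z. \<exists>x. z = pr x (f x))"
  proof (rule bounded_fm_recp[where e = e])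
    show "bounded_fm (exb 2 (Var 0) (exb 3 (Var 0) (Conj (Eq (Var 0) (pairt (Var 2) (Var 3))) \<phi>)))"
      using assms(1) by (simp add: bounded_exb)
    show "sat M (e(0 := z, 1 := a)) E (exb 2 (Var 0) (exb 3 (Var 0)
      (Conj (Eq (Var 0) (pairt (Var 2) (Var 3))) \<phi>))) \<longleftrightarrow> (\<exists>x. z = pr x (f x))" for z a
      using assms(3)[of z a]
      by (auto simp add: sat_exb tval_pairt simp del: tval.simps(4,5) One_nat_def)
  qed (fact assms(2))
  then show ?thesis
    by (simp add: recp_def recf_def)
qed

lemma recf_id: "recf (\<lambda>x. x)"
  by (rule recf_fm[of "Eq (Var 3) (Var 2)", OF _ range_some_sets]) simp_all

lemma recf_const: "recf (\<lambda>x. c)"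
  by (rule recf_fm[of "Eq (Var 3) (Var 10)", OF _ range_some_sets, where e = "\<lambda>_. c"]) simp_all

lemma recf_pfst: "recf pfst"
proof -
  let ?P = "exb 4 (Var 2) (exb 5 (Var 2) (Eq (Var 2) (pairt (Var 4) (Var 5))))"
  let ?Q = "exb 4 (Var 2) (exb 5 (Var 2) (Conj (Eq (Var 2) (pairt (Var 4) (Var 5))) (Eq (Var 3) (Var 4))))"
  have "v = pfst x \<longleftrightarrow> (\<exists>i j. i \<sqsubseteq> x \<and> j \<sqsubseteq> x \<and> x = pr i j \<and> v = i) \<or>
      \<not> (\<exists>i j. i \<sqsubseteq> x \<and> j \<sqsubseteq> x \<and> x = pr i j) \<and> v = \<zero>" for v x
  proof (cases "\<exists>i j. x = pr i j")
    case True
    then obtain i j where x: "x = pr i j" by blast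
    show ?thesis unfolding x by simp
  next
    case False
    then have "pfst x = \<zero>" by (simp add: pfst_def)
    with False show ?thesis by auto
  qed
  then show ?thesis
    by (intro recf_fm[of "Neg (Conj (Neg ?Q) (Neg (Conj (Neg ?P) (Eq (Var 3) Zero))))", OF _ range_some_sets])
      (auto simp: bounded_exb sat_exb tval_pairt simp del: tval.simps(4,5))
qed

lemma recf_psnd: "recf psnd"
proof -
  let ?P = "exb 4 (Var 2) (exb 5 (Var 2) (Eq (Var 2) (pairt (Var 4) (Var 5))))"
  let ?Q = "exb 4 (Var 2) (exb 5 (Var 2) (Conj (Eq (Var 2) (pairt (Var 4) (Var 5))) (Eq (Var 3) (Var 5))))"
  have "v = psnd x \<longleftrightarrow> (\<exists>i j. i \<sqsubseteq> x \<and> j \<sqsubseteq> x \<and> x = pr i j \<and> v = j) \<or>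
      \<not> (\<exists>i j. i \<sqsubseteq> x \<and> j \<sqsubseteq> x \<and> x = pr i j) \<and> v = \<zero>" for v x
  proof (cases "\<exists>i j. x = pr i j")
    case True
    then obtain i j where x: "x = pr i j" by blast
    show ?thesis unfolding x by simp
  next
    case False
    then have "psnd x = \<zero>" by (simp add: psnd_def)
    with False show ?thesis by auto
  qed
  then show ?thesis
    by (intro recf_fm[of "Neg (Conj (Neg ?Q) (Neg (Conj (Neg ?P) (Eq (Var 3) Zero))))", OF _ range_some_sets])
      (auto simp: bounded_exb sat_exb tval_pairt simp del: tval.simps(4,5))
qed

lemma range_graphs:
  "recf f \<Longrightarrow> recf g \<Longrightarrow> range (sets2 {pr x (f x) | x. True} {pr x (g x) | x. True}) \<subseteq> set_part M"
  by (simp add: range_sets2 recf_def)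

lemma recf_pr:
  assumes "recf f" "recf g" shows "recf (\<lambda>x. pr (f x) (g x))"
  by (rule recf_fm[of "exb 4 (Var 3) (exb 5 (Var 3) (Conj (Eq (Var 3) (pairt (Var 4) (Var 5)))
      (Conj (Mem (pairt (Var 2) (Var 4)) 0) (Mem (pairt (Var 2) (Var 5)) 1))))", OF _ range_graphs[OF assms]])
    (auto simp: bounded_exb sat_exb tval_pairt simp del: tval.simps(4,5))

text \<open>The intermediate value \<open>g x\<close> is the unbounded variable 1. Its existential
  and universal versions agree because \<open>g\<close> is total and single-valued.\<close>

lemma recf_comp:
  assumes "recf f" "recf g" shows "recf (\<lambda>x. f (g x))"
proof -
  have "recp (\<lambda>z. \<exists>x. z = pr x (f (g x)))"
    by (rule delta1_fm[of "exb 2 (Var 0) (exb 3 (Var 0) (Conj (Eq (Var 0) (pairt (Var 2) (Var 3)))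
        (Conj (Mem (pairt (Var 2) (Var 1)) 1) (Mem (pairt (Var 1) (Var 3)) 0))))"
       "exb 2 (Var 0) (exb 3 (Var 0) (Conj (Eq (Var 0) (pairt (Var 2) (Var 3)))
        (Neg (Conj (Mem (pairt (Var 2) (Var 1)) 1) (Neg (Mem (pairt (Var 1) (Var 3)) 0))))))",
       OF _ _ range_graphs[OF assms]])
      (auto simp: bounded_exb sat_exb tval_pairt simp del: tval.simps(4,5), metis pr_inject)
  then show ?thesis
    by (simp add: recp_def recf_def)
qed

definition recf2 :: "('a \<Rightarrow> 'a \<Rightarrow> 'a) \<Rightarrow> bool" where
  "recf2 h \<longleftrightarrow> recf (\<lambda>z. h (pfst z) (psnd z))"
definition recp2 :: "('a \<Rightarrow> 'a \<Rightarrow> bool) \<Rightarrow> bool" where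
  "recp2 P \<longleftrightarrow> recp (\<lambda>z. P (pfst z) (psnd z))"

lemma recf2_comp: "recf2 h \<Longrightarrow> recf f \<Longrightarrow> recf g \<Longrightarrow> recf (\<lambda>x. h (f x) (g x))"
  using recf_comp[OF _ recf_pr, of "\<lambda>z. h (pfst z) (psnd z)"] by (simp add: recf2_def)

lemma recp2_comp: "recp2 P \<Longrightarrow> recf f \<Longrightarrow> recf g \<Longrightarrow> recp (\<lambda>x. P (f x) (g x))"
  using recp_comp[OF _ recf_pr, of "\<lambda>z. P (pfst z) (psnd z)"] by (simp add: recp2_def)

lemma recf2_add: "recf2 (\<oplus>)"
  unfolding recf2_def
  by (rule recf_fm[of "exb 4 (Var 2) (exb 5 (Var 2) (Conj (Eq (Var 3) (Plus (Var 4) (Var 5)))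
      (Conj (Mem (pairt (Var 2) (Var 4)) 0) (Mem (pairt (Var 2) (Var 5)) 1))))", OF _ range_graphs[OF recf_pfst recf_psnd]])
    (auto simp: bounded_exb sat_exb tval_pairt pfst_leq psnd_leq simp del: tval.simps(4,5), auto simp: pfst_leq psnd_leq)

lemma recf2_mul: "recf2 (\<otimes>)"
  unfolding recf2_def
  by (rule recf_fm[of "exb 4 (Var 2) (exb 5 (Var 2) (Conj (Eq (Var 3) (Times (Var 4) (Var 5)))
      (Conj (Mem (pairt (Var 2) (Var 4)) 0) (Mem (pairt (Var 2) (Var 5)) 1))))", OF _ range_graphs[OF recf_pfst recf_psnd]])
    (auto simp: bounded_exb sat_exb tval_pairt pfst_leq psnd_leq simp del: tval.simps(4,5), auto simp: pfst_leq psnd_leq)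

lemma recp2_less: "recp2 (\<sqsubset>)"
  unfolding recp2_def
  by (rule bounded_fm_recp[of "exb 4 (Var 0) (exb 5 (Var 0) (Conj (Less (Var 4) (Var 5))
      (Conj (Mem (pairt (Var 0) (Var 4)) 0) (Mem (pairt (Var 0) (Var 5)) 1))))", OF _ range_graphs[OF recf_pfst recf_psnd]])
    (auto simp: bounded_exb sat_exb tval_pairt pfst_leq psnd_leq simp del: tval.simps(4,5))

lemma recp2_eq: "recp2 (=)"
  unfolding recp2_def
  by (rule bounded_fm_recp[of "exb 4 (Var 0) (exb 5 (Var 0) (Conj (Eq (Var 4) (Var 5))
      (Conj (Mem (pairt (Var 0) (Var 4)) 0) (Mem (pairt (Var 0) (Var 5)) 1))))", OF _ range_graphs[OF recf_pfst recf_psnd]])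
    (auto simp: bounded_exb sat_exb tval_pairt pfst_leq psnd_leq simp del: tval.simps(4,5))

text \<open>The base case for bounded quantification, where the bound is itself a variable and hence
  a term of the language.\<close>

lemma recp_all_below_arg:
  assumes "recp P" shows "recp (\<lambda>x. \<forall>y. y \<sqsubset> x \<longrightarrow> P (pr x y))"
  by (rule bounded_fm_recp[of "All 2 (Neg (Conj (Less (Var 2) (Var 0)) (Neg (Mem (pairt (Var 0) (Var 2)) 0))))" "\<lambda>_. {x. P x}"])
    (use assms in \<open>auto simp: recp_def tval_pairt intro!: bounded_fm.intros simp del: tval.simps(4,5)\<close>)

text \<open>
  Recursiveness goals are closed by \<open>intro rec_intros\<close>.  Since the rules are unary, the variable
  bound by a bounded quantifier is paired with the parameter and both reappear as projections.
\<close>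

named_theorems rec_intros

lemmas [rec_intros] = recf_id recf_const recf_pr recf_comp[OF recf_pfst] recf_comp[OF recf_psnd]
  recf2_comp[OF recf2_add] recf2_comp[OF recf2_mul] recp2_comp[OF recp2_less] recp2_comp[OF recp2_eq]
  recp_not recp_conj

lemma recp_disj [rec_intros]:
  assumes "recp P" "recp Q" shows "recp (\<lambda>x. P x \<or> Q x)"
  using recp_not[OF recp_conj[OF recp_not[OF assms(1)] recp_not[OF assms(2)]]] by simp

lemma recp_imp [rec_intros]:
  assumes "recp P" "recp Q" shows "recp (\<lambda>x. P x \<longrightarrow> Q x)"
  unfolding imp_conv_disj by (intro recp_disj recp_not assms)

lemma recp_iff [rec_intros]:
  assumes "recp P" "recp Q" shows "recp (\<lambda>x. P x \<longleftrightarrow> Q x)"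
  unfolding iff_conv_conj_imp by (intro recp_conj recp_imp assms)

lemma recp_mem [rec_intros]: "A \<in> set_part M \<Longrightarrow> recf f \<Longrightarrow> recp (\<lambda>x. f x \<in> A)"
  using recp_comp[of "\<lambda>x. x \<in> A" f] by (simp add: recp_def)

lemma recp_leq [rec_intros]: "recf f \<Longrightarrow> recf g \<Longrightarrow> recp (\<lambda>x. f x \<sqsubseteq> g x)"
  unfolding leq_def by (intro rec_intros)

text \<open>The bound \<open>b x\<close> is no term. The previous lemma is therefore used at the
  argument \<open>pr (b x) x\<close>, which is at least \<open>b x\<close> and still carries
  \<open>x\<close>; the premise of \<open>?R\<close> cuts the range back to
  \<open>b x\<close>.\<close>

lemma recp_all [rec_intros]:
  assumes "recf b" and "recp (\<lambda>z. P (pfst z) (psnd z))"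
  shows "recp (\<lambda>x. \<forall>y. y \<sqsubset> b x \<longrightarrow> P x y)"
proof -
  let ?R = "\<lambda>w. psnd w \<sqsubset> pfst (pfst w) \<longrightarrow> P (psnd (pfst w)) (psnd w)"
  have "recp (\<lambda>w. P (psnd (pfst w)) (psnd w))"
    using recp2_comp[of P "\<lambda>w. psnd (pfst w)" psnd] assms(2) unfolding recp2_def
    by (simp add: recf_comp recf_pfst recf_psnd)
  then have "recp ?R"
    by (intro rec_intros recf_pfst recf_psnd)
  then have "recp (\<lambda>w. \<forall>y. y \<sqsubset> w \<longrightarrow> ?R (pr w y))"
    by (rule recp_all_below_arg)
  moreover have "recf (\<lambda>x. pr (b x) x)"
    using assms(1) by (intro rec_intros)
  ultimately have "recp (\<lambda>x. \<forall>y. y \<sqsubset> pr (b x) x \<longrightarrow> ?R (pr (pr (b x) x) y))"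
    by (rule recp_comp)
  moreover have "(\<forall>y. y \<sqsubset> pr (b x) x \<longrightarrow> ?R (pr (pr (b x) x) y)) \<longleftrightarrow> (\<forall>y. y \<sqsubset> b x \<longrightarrow> P x y)" for x
    using N.less_le_trans[OF _ leq_pr1] by auto
  ultimately show ?thesis by simp
qed

lemma recp_ex [rec_intros]:
  assumes "recf b" and "recp (\<lambda>z. P (pfst z) (psnd z))"
  shows "recp (\<lambda>x. \<exists>y. y \<sqsubset> b x \<and> P x y)"
  using recp_not[OF recp_all[OF assms(1) recp_not[OF assms(2)]]] by simp

lemma recf_iff: "recf f \<longleftrightarrow> recp (\<lambda>z. psnd z = f (pfst z))"
proof
  assume "recf f"
  then show "recp (\<lambda>z. psnd z = f (pfst z))"
    by (intro rec_intros recf_comp[OF \<open>recf f\<close>])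
next
  assume "recp (\<lambda>z. psnd z = f (pfst z))"
  then have "recp (\<lambda>z. z = pr (pfst z) (psnd z) \<and> psnd z = f (pfst z))"
    by (intro recp_conj) (intro rec_intros)
  moreover have "(z = pr (pfst z) (psnd z) \<and> psnd z = f (pfst z)) \<longleftrightarrow> (\<exists>x. z = pr x (f x))" for z
    by (auto simp: pfst_pr psnd_pr)
  ultimately show "recf f"
    by (simp add: recp_def recf_def)
qed

section \<open>Induction and minimization for recursive predicates\<close>

lemma sigma1_induct:
  assumes "recp2 Q" "\<exists>y. Q \<zero> y" "\<And>n. \<exists>y. Q n y \<Longrightarrow> \<exists>y. Q (n \<oplus> \<one>) y"
  shows "\<exists>y. Q n y"
  by (rule sigma1_induct_fm[of "Mem (pairt (Var 0) (Var 1)) 0" "\<lambda>_. {z. Q (pfst z) (psnd z)}"])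
    (use assms in \<open>auto simp: recp_def recp2_def tval_pairt simp del: tval.simps(4,5)\<close>)

lemma rec_induct:
  assumes "recp P" "P \<zero>" "\<And>n. P n \<Longrightarrow> P (n \<oplus> \<one>)"
  shows "P n"
  using sigma1_induct[of "\<lambda>n _. P n"] assms recp_comp[OF assms(1) recf_pfst]
  by (auto simp: recp2_def)

lemma ex_least:
  assumes "recp P" "P n" shows "\<exists>m. P m \<and> (\<forall>y. y \<sqsubset> m \<longrightarrow> \<not> P y)"
proof (rule ccontr)
  assume no: "\<not> ?thesis"
  have "recp (\<lambda>n. \<forall>y. y \<sqsubset> n \<longrightarrow> \<not> P y)"
    by (intro rec_intros recp_comp[OF assms(1)] recf_psnd)
  then have "\<forall>y. y \<sqsubset> n \<oplus> \<one> \<longrightarrow> \<not> P y"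
    by (rule rec_induct) (use no lt_succ in auto)
  then show False
    using assms(2) lt_succ by blast
qed

definition least :: "('a \<Rightarrow> bool) \<Rightarrow> 'a" where
  "least P = (THE m. P m \<and> (\<forall>y. y \<sqsubset> m \<longrightarrow> \<not> P y))"

lemma least_eqI: "P m \<Longrightarrow> (\<And>y. y \<sqsubset> m \<Longrightarrow> \<not> P y) \<Longrightarrow> least P = m"
  unfolding least_def by (rule the_equality) (auto intro: N.linorder_cases)

lemma least:
  assumes "recp P" "P n"
  shows "P (least P)" "y \<sqsubset> least P \<Longrightarrow> \<not> P y" "P y \<Longrightarrow> least P \<sqsubseteq> y"
proof -
  obtain m where "P m" "\<forall>y. y \<sqsubset> m \<longrightarrow> \<not> P y"
    using ex_least[OF assms] by blast
  then have "least P = m" by (blast intro: least_eqI)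
  with \<open>P m\<close> \<open>\<forall>y. y \<sqsubset> m \<longrightarrow> \<not> P y\<close>
  show "P (least P)" "y \<sqsubset> least P \<Longrightarrow> \<not> P y" "P y \<Longrightarrow> least P \<sqsubseteq> y"
    by (auto simp: N.not_less[symmetric])
qed

lemma recp2_arg: "recp2 P \<Longrightarrow> recp (P x)"
  using recp2_comp[OF _ recf_const recf_id] by blast

text \<open>Unbounded search. Totality makes the graph definable by "\<open>P x v\<close> holds and
  fails for all smaller numbers", in which the only quantifier is bounded.\<close>

lemma recf_least:
  assumes "recp2 P" "\<And>x. \<exists>y. P x y" shows "recf (\<lambda>x. least (P x))"
proof -
  have "least (P x) = v \<longleftrightarrow> P x v \<and> (\<forall>y. y \<sqsubset> v \<longrightarrow> \<not> P x y)" for x v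
    using least[OF recp2_arg[OF assms(1)]] assms(2) least_eqI by metis
  then have eq: "(psnd z = least (P (pfst z))) \<longleftrightarrow> P (pfst z) (psnd z) \<and> (\<forall>y. y \<sqsubset> psnd z \<longrightarrow> \<not> P (pfst z) y)" for z
    by metis
  show ?thesis
    unfolding recf_iff eq
    by (intro rec_intros recp2_comp[OF assms(1)] recf_psnd recf_pfst)
qed

end

section \<open>Codes of finite sets\<close>

context rca0
begin

lemma recf_if [rec_intros]:
  assumes "recp P" "recf f" "recf g" shows "recf (\<lambda>x. if P x then f x else g x)"
proof -
  have "(psnd z = (if P (pfst z) then f (pfst z) else g (pfst z))) \<longleftrightarrow>
      P (pfst z) \<and> psnd z = f (pfst z) \<or> \<not> P (pfst z) \<and> psnd z = g (pfst z)" for z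
    by auto
  then show ?thesis
    unfolding recf_iff
    by (simp only:) (intro rec_intros recp_comp[OF assms(1)] recf_comp[OF assms(2)] recf_comp[OF assms(3)] recf_pfst recf_psnd)
qed

section \<open>Divisibility and pairwise coprime moduli\<close>

abbreviation divides :: "'a \<Rightarrow> 'a \<Rightarrow> bool" (infix "dvds" 50) where
  "divides \<equiv> dvd.dvd (\<otimes>)"

text \<open>A nonzero divisor leaves a cofactor of at most \<open>n\<close>, so divisibility is a
  bounded statement and thus recursive.\<close>

lemma dvds_bounded:
  assumes "a \<noteq> \<zero>" shows "a dvds n \<longleftrightarrow> (\<exists>d. d \<sqsubset> n \<oplus> \<one> \<and> n = a \<otimes> d)"
proof -
  have "d \<sqsubseteq> a \<otimes> d" for d
  proof -
    have "\<one> \<sqsubseteq> a"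
      using assms succ_leq_iff[of \<zero>] by (simp add: zero_lt_iff)
    then have "\<one> \<otimes> d \<sqsubseteq> a \<otimes> d"
      by (intro N.mult_right_mono) auto
    then show ?thesis by simp
  qed
  then show ?thesis
    by (auto simp: N.dvd_def less_succ_iff)
qed

text \<open>The moduli of Goedel's beta function; they are exactly the divisors tested in
  \<open>elems\<close>.\<close>

definition modulus :: "'a \<Rightarrow> 'a \<Rightarrow> 'a" where "modulus m i = m \<otimes> (i \<oplus> \<one>) \<oplus> \<one>"

lemma modulus_neq_zero [simp]: "modulus m i \<noteq> \<zero>"
  by (simp add: modulus_def)

lemma recf_modulus [rec_intros]: "recf f \<Longrightarrow> recf g \<Longrightarrow> recf (\<lambda>x. modulus (f x) (g x))"
  unfolding modulus_def by (intro rec_intros)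

lemma recp_dvds:
  assumes "recf f" "recf g" "\<And>x. f x \<noteq> \<zero>" shows "recp (\<lambda>x. f x dvds g x)"
  unfolding dvds_bounded[OF assms(3)]
  by (intro rec_intros assms recf_comp[OF assms(1)] recf_comp[OF assms(2)])

definition common_multiple :: "('a \<Rightarrow> 'a) \<Rightarrow> 'a \<Rightarrow> 'a \<Rightarrow> bool" where
  "common_multiple g h T \<longleftrightarrow> T \<noteq> \<zero> \<and> (\<forall>i. i \<sqsubset> h \<longrightarrow> g i dvds T)"

lemma recp_common_multiple:
  assumes "recf2 g" "\<And>x i. g x i \<noteq> \<zero>" "recf f" "recf b" "recf h"
  shows "recp (\<lambda>x. common_multiple (g (f x)) (h x) (b x))"
  unfolding common_multiple_def
  by (intro rec_intros recp_dvds assms recf2_comp[OF assms(1)] recf_comp[OF assms(3)] recf_comp[OF assms(4)])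

text \<open>The product would do, but stating mere existence makes this a \<Sigma>1 induction: the
  old witness is multiplied by \<open>g n\<close>.\<close>

lemma ex_common_multiple:
  assumes "recf g" "\<And>i. g i \<noteq> \<zero>" shows "\<exists>T. common_multiple g h T"
proof (rule sigma1_induct[of "common_multiple g"])
  show "recp2 (common_multiple g)"
    unfolding recp2_def
    using assms by (intro recp_common_multiple[of "\<lambda>x. g", where f = "\<lambda>x. x"])
      (simp_all add: recf2_def recf_comp recf_pfst recf_psnd recf_id)
  show "\<exists>y. common_multiple g \<zero> y"
    using N.zero_neq_one by (intro exI[of _ \<one>]) (auto simp: common_multiple_def)
  fix n assume "\<exists>y. common_multiple g n y"
  then obtain y where "common_multiple g n y" ..
  then have "common_multiple g (n \<oplus> \<one>) (y \<otimes> g n)"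
    using assms(2) by (auto simp: common_multiple_def lt_succ)
  then show "\<exists>y. common_multiple g (n \<oplus> \<one>) y" ..
qed

text \<open>As \<open>d\<close> divides \<open>m\<close>, it is coprime to
  \<open>modulus m i\<close>. With \<open>m = d * e\<close> this is the subtraction-free Bezout
  identity \<open>d * n * (e * (i + 1)) + n = modulus m i * n\<close>: the modulus divides the sum
  and the first summand, hence \<open>n\<close>.\<close>

lemma modulus_dvds_cancel:
  assumes "common_multiple (\<lambda>i. i \<oplus> \<one>) h m" "d \<noteq> \<zero>" "d \<sqsubseteq> h"
    and "modulus m i dvds d \<otimes> n"
  shows "modulus m i dvds n"
proof -
  obtain d' where d': "d = d' \<oplus> \<one>"
    using assms(2) zero_or_succ by blast
  with assms(1,3) have "d dvds m"
    by (auto simp: common_multiple_def succ_leq_iff)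
  then obtain e where e: "m = d \<otimes> e"
    by (auto simp: N.dvd_def)
  have "modulus m i dvds (d \<otimes> n) \<otimes> (e \<otimes> (i \<oplus> \<one>))"
    by (rule N.dvd_mult2[OF assms(4)])
  moreover have "(d \<otimes> n) \<otimes> (e \<otimes> (i \<oplus> \<one>)) \<oplus> n = modulus m i \<otimes> n"
    unfolding modulus_def distrib_right one_mul e by (simp add: N.mult.assoc N.mult.left_commute N.mult.commute)
  ultimately show ?thesis
    using N.dvd_add_right_iff N.dvd_triv_left by metis
qed

text \<open>Distinct moduli below \<open>h\<close> are coprime. A combination of the two equals the
  difference \<open>d\<close> of the indices, so divisibility of the product by
  \<open>modulus m i\<close> passes to \<open>d * n\<close>, where \<open>d\<close> can be cancelled
  as it is at most \<open>h\<close>.\<close>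

lemma modulus_dvds_modulus_cancel:
  assumes "common_multiple (\<lambda>i. i \<oplus> \<one>) h m" "i \<sqsubset> h" "j \<sqsubset> h" "i \<noteq> j"
    and dvd: "modulus m i dvds modulus m j \<otimes> n"
  shows "modulus m i dvds n"
proof -
  \<comment> \<open>Both sides share the summand with factor \<open>m\<close>; what remains is
    \<open>i + d + 1\<close> on the left and \<open>(i + 1) + d\<close> on the right. Without
    negative numbers, the order of \<open>i\<close> and \<open>j\<close> decides which way the
    identity is read.\<close>
  have *: "(i \<oplus> d \<oplus> \<one>) \<otimes> modulus m i = (i \<oplus> \<one>) \<otimes> modulus m (i \<oplus> d) \<oplus> d" for i d
  proof -
    have "(i \<oplus> d \<oplus> \<one>) \<otimes> (m \<otimes> (i \<oplus> \<one>)) = (i \<oplus> \<one>) \<otimes> (m \<otimes> (i \<oplus> d \<oplus> \<one>))"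
      by (simp only: N.mult.commute N.mult.left_commute)
    then show ?thesis
      unfolding modulus_def distrib_left[of _ _ \<one>] mul_one
      by (simp only: N.add.assoc N.add.commute N.add.left_commute)
  qed
  have dvd': "modulus m i dvds (a \<otimes> modulus m j) \<otimes> n" for a
    using dvd by (simp add: N.mult.assoc)
  show ?thesis
  proof (cases "i \<sqsubset> j")
    case True
    then obtain d where d: "j = i \<oplus> d" "d \<noteq> \<zero>"
      unfolding lt_iff by auto
    have "modulus m i dvds ((i \<oplus> \<one>) \<otimes> modulus m j) \<otimes> n \<oplus> d \<otimes> n"
    proof -
      have "((i \<oplus> \<one>) \<otimes> modulus m j) \<otimes> n \<oplus> d \<otimes> n = ((j \<oplus> \<one>) \<otimes> modulus m i) \<otimes> n"
        unfolding distrib_right[symmetric] d *[symmetric] ..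
      then show ?thesis by (simp add: N.dvd_mult2)
    qed
    then have "modulus m i dvds d \<otimes> n"
      using dvd' N.dvd_add_right_iff by blast
    moreover have "d \<sqsubseteq> h"
    proof -
      have "d \<sqsubseteq> j" by (simp add: d)
      with assms(3) show ?thesis by order
    qed
    ultimately show ?thesis
      using assms(1) d(2) modulus_dvds_cancel by blast
  next
    case False
    then have "j \<sqsubset> i" using assms(4) by order
    then obtain d where d: "i = j \<oplus> d" "d \<noteq> \<zero>"
      unfolding lt_iff by auto
    have "((i \<oplus> \<one>) \<otimes> modulus m j) \<otimes> n = ((j \<oplus> \<one>) \<otimes> modulus m i) \<otimes> n \<oplus> d \<otimes> n"
      unfolding d * distrib_right[of "(j \<oplus> \<one>) \<otimes> modulus m (j \<oplus> d)"] ..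
    then have "modulus m i dvds ((j \<oplus> \<one>) \<otimes> modulus m i) \<otimes> n \<oplus> d \<otimes> n"
      using dvd'[of "i \<oplus> \<one>"] by simp
    moreover have "modulus m i dvds ((j \<oplus> \<one>) \<otimes> modulus m i) \<otimes> n"
      by (simp add: N.dvd_mult2)
    ultimately have "modulus m i dvds d \<otimes> n"
      using N.dvd_add_right_iff by blast
    moreover have "d \<sqsubseteq> h"
    proof -
      have "d \<sqsubseteq> i" by (simp add: d)
      with assms(2) show ?thesis by order
    qed
    ultimately show ?thesis
      using assms(1) d(2) modulus_dvds_cancel by blast
  qed
qed

lemma elems_pr: "elems M (pr k (pr m n)) = {i. i \<sqsubset> k \<and> modulus m i dvds n}"
  unfolding elems_def modulus_def N.dvd_def by (auto simp: N.mult.commute)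

lemma elems_less: "i \<in> elems M c \<Longrightarrow> i \<sqsubset> c"
  unfolding elems_def using N.less_le_trans leq_pr1 by blast

lemma triple_codes_iff: "c \<in> triple_codes M \<longleftrightarrow> c = pr (pfst c) (pr (pfst (psnd c)) (psnd (psnd c)))"
  unfolding triple_codes_def by auto

text \<open>Projections replace the existential quantifiers over the components of the triple, so
  that membership is visibly recursive.\<close>

lemma elems_iff: "i \<in> elems M c \<longleftrightarrow> c \<in> triple_codes M \<and> i \<sqsubset> pfst c \<and> modulus (pfst (psnd c)) i dvds psnd (psnd c)"
proof (cases "c \<in> triple_codes M")
  case True
  then obtain k m n where "c = pr k (pr m n)" by (auto simp: triple_codes_def)
  with True show ?thesis by (simp add: elems_pr)
next
  case False
  then show ?thesis by (auto simp: elems_def triple_codes_def)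
qed

lemma recp_triple_codes [rec_intros]: "recf f \<Longrightarrow> recp (\<lambda>x. f x \<in> triple_codes M)"
  unfolding triple_codes_iff by (intro rec_intros)

lemma recp_elems [rec_intros]: "recf f \<Longrightarrow> recf g \<Longrightarrow> recp (\<lambda>x. f x \<in> elems M (g x))"
  unfolding elems_iff by (intro rec_intros recp_dvds) auto

text \<open>
  A bound for the codes of all subsets of \<open>{0, \<dots>, h - 1}\<close>.  It makes quantifiers over strings
  of given length bounded, so that they may occur inside \<open>\<Sigma>\<^sub>1\<close> induction.
\<close>

definition code_bound :: "'a \<Rightarrow> 'a" where
  "code_bound h =
    (let m = least (common_multiple (\<lambda>i. i \<oplus> \<one>) h)
     in pr h (pr m (least (common_multiple (modulus m) h))))"

lemma recp2_common_multiple: "recf2 g \<Longrightarrow> (\<And>x i. g x i \<noteq> \<zero>) \<Longrightarrow> recp2 (common_multiple (g x))"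
  unfolding recp2_def using recp_common_multiple[OF _ _ recf_const recf_psnd recf_pfst] by blast

lemma recf_succ: "recf (\<lambda>i. i \<oplus> \<one>)"
  by (intro rec_intros)

lemma recf2_modulus: "recf2 modulus"
  unfolding recf2_def by (intro rec_intros)

lemma ex_common_multiple_modulus: "\<exists>T. common_multiple (modulus m) h T"
  by (intro ex_common_multiple) (auto intro!: rec_intros)

lemma ex_common_multiple_succ: "\<exists>T. common_multiple (\<lambda>i. i \<oplus> \<one>) h T"
  by (intro ex_common_multiple) (auto intro!: rec_intros)

lemma recf_code_bound: "recf code_bound"
proof -
  have 1: "recf (\<lambda>h. least (common_multiple (\<lambda>i. i \<oplus> \<one>) h))" (is "recf ?m")
    by (intro recf_least recp2_common_multiple[of "\<lambda>_ i. i \<oplus> \<one>"] ex_common_multiple_succ)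
      (auto simp: recf2_def intro!: rec_intros)
  have "recf (\<lambda>h. least (common_multiple (modulus (?m h)) h))"
    by (intro recf_least ex_common_multiple_modulus)
      (auto simp: recp2_def intro!: rec_intros recp_common_multiple recf2_modulus recf_comp[OF 1])
  then show ?thesis
    unfolding code_bound_def Let_def by (intro rec_intros recf_comp[OF 1])
qed

lemma least_common_multiple:
  assumes "recf g" "\<And>i. g i \<noteq> \<zero>"
  shows "common_multiple g h (least (common_multiple g h))"
proof -
  obtain T where "common_multiple g h T"
    using ex_common_multiple[OF assms] ..
  moreover have "recp (common_multiple g h)"
    using recp_common_multiple[of "\<lambda>_. g" "\<lambda>x. x" "\<lambda>x. x" "\<lambda>_. h"] assms
    by (simp add: recf2_def recf_id recf_const recf_comp recf_psnd)
  ultimately show ?thesis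
    using least(1)[of "common_multiple g h"] by blast
qed

text \<open>
  The least common multiple \<open>n\<close> of the moduli indexed by \<open>P\<close> replaces their product, whose
  definition would need primitive recursion.  Any other modulus dividing \<open>n\<close> could be cancelled, contradicting minimality.
\<close>

lemma ex_triple_code:
  assumes "recp P" "\<And>i. P i \<Longrightarrow> i \<sqsubset> h"
  shows "\<exists>c \<in> triple_codes M. elems M c = {i. P i} \<and> c \<sqsubseteq> code_bound h"
proof -
  define m where "m = least (common_multiple (\<lambda>i. i \<oplus> \<one>) h)"
  define T where "T = least (common_multiple (modulus m) h)"
  have m: "common_multiple (\<lambda>i. i \<oplus> \<one>) h m"
    unfolding m_def by (intro least_common_multiple recf_succ succ_ne)
  have T: "common_multiple (modulus m) h T"
    unfolding T_def by (intro least_common_multiple modulus_neq_zero) (intro rec_intros)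
  let ?R = "\<lambda>n. n \<noteq> \<zero> \<and> (\<forall>i. i \<sqsubset> h \<longrightarrow> P i \<longrightarrow> modulus m i dvds n)"
  have recp_R: "recp ?R"
    by (intro rec_intros recp_dvds recp_comp[OF assms(1)] recf_psnd recf_pfst) auto
  have RT: "?R T" using T by (auto simp: common_multiple_def)
  define n where "n = least ?R"
  \<comment> \<open>\<open>T\<close> satisfies \<open>?R\<close> whatever \<open>P\<close> is. The
    bound \<open>n \<le> T\<close> therefore leads to a code bound that depends on \<open>h\<close>
    alone.\<close>
  have n: "?R n" "n \<sqsubseteq> T" and n_least: "\<And>n'. n' \<sqsubset> n \<Longrightarrow> \<not> ?R n'"
    unfolding n_def using least[OF recp_R RT] RT by blast+
  have "P j" if j: "j \<sqsubset> h" "modulus m j dvds n" for j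
  proof (rule ccontr)
    assume "\<not> P j"
    obtain n' where n': "n = modulus m j \<otimes> n'"
      using j(2) by (auto simp: N.dvd_def)
    have "n' \<noteq> \<zero>" using n n' by auto
    moreover have "modulus m i dvds n'" if "i \<sqsubset> h" "P i" for i
      using modulus_dvds_modulus_cancel[OF m, of i j n'] that j \<open>\<not> P j\<close> n(1) n' by blast
    ultimately have "?R n'" by blast
    moreover have "n' \<sqsubset> n"
    proof -
      \<comment> \<open>Strict because \<open>m\<close> is nonzero, so cancelling the modulus yields
        a strictly smaller number.\<close>
      have "\<one> \<sqsubset> modulus m j"
        using m by (simp add: modulus_def common_multiple_def zero_lt_iff)
      then have "\<one> \<otimes> n' \<sqsubset> modulus m j \<otimes> n'"
        using \<open>n' \<noteq> \<zero>\<close> by (intro N.mult_strict_right_mono) (auto simp: zero_lt_iff)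
      then show ?thesis by (simp add: n')
    qed
    ultimately show False using n_least by blast
  qed
  then have "elems M (pr h (pr m n)) = {i. P i}"
    using n(1) assms(2) by (auto simp: elems_pr)
  moreover have "pr h (pr m n) \<sqsubseteq> code_bound h"
    using n(2) by (simp add: code_bound_def Let_def pr_mono flip: m_def T_def)
  moreover have "pr h (pr m n) \<in> triple_codes M"
    by (auto simp: triple_codes_def)
  ultimately show ?thesis by blast
qed

text \<open>Official codes are least triples; passing to the least triple with the same elements
  only lowers the code, so the bound survives.\<close>

lemma finset_code_ex:
  assumes "recp P" "\<And>i. P i \<Longrightarrow> i \<sqsubset> h"
  shows "\<exists>c \<in> finset_codes M. elems M c = {i. P i} \<and> c \<sqsubseteq> code_bound h"
proof -
  obtain c where c: "c \<in> triple_codes M" "elems M c = {i. P i}" "c \<sqsubseteq> code_bound h"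
    using ex_triple_code[OF assms] by blast
  define R where "R = (\<lambda>c'. c' \<in> triple_codes M \<and> elems M c' = elems M c)"
  \<comment> \<open>Elements are smaller than their code, so equality of the two sets can be tested
    below \<open>c' + c\<close>, a recursive condition.\<close>
  have "elems M c' = elems M c \<longleftrightarrow> (\<forall>i. i \<sqsubset> c' \<oplus> c \<longrightarrow> (i \<in> elems M c' \<longleftrightarrow> i \<in> elems M c))" for c'
  proof -
    have "c' \<sqsubseteq> c' \<oplus> c" "c \<sqsubseteq> c' \<oplus> c" by simp_all
    then show ?thesis
      using elems_less N.less_le_trans by blast
  qed
  then have "recp R"
    unfolding R_def by (simp only:) (intro rec_intros)
  moreover have "R c" using c by (simp add: R_def)
  ultimately have "R (least R)" "least R \<sqsubseteq> c" "\<And>c'. c' \<sqsubset> least R \<Longrightarrow> \<not> R c'"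
    using least[of R] by blast+
  then have "least R \<in> finset_codes M" "elems M (least R) = {i. P i}" "least R \<sqsubseteq> code_bound h"
    using c unfolding R_def finset_codes_def by (auto intro: N.order_trans)
  then show ?thesis by blast
qed

lemma finset_code_unique:
  "c \<in> finset_codes M \<Longrightarrow> c' \<in> finset_codes M \<Longrightarrow> elems M c = elems M c' \<Longrightarrow> c = c'"
  unfolding finset_codes_def using N.less_linear[of c c'] by force

lemma recp_finset_codes [rec_intros]:
  assumes "recf f" shows "recp (\<lambda>x. f x \<in> finset_codes M)"
proof -
  have "c \<in> finset_codes M \<longleftrightarrow> c \<in> triple_codes M \<and> (\<forall>c'. c' \<sqsubset> c \<longrightarrow> c' \<in> triple_codes M \<longrightarrow>
      (\<exists>i. i \<sqsubset> c \<and> \<not> (i \<in> elems M c' \<longleftrightarrow> i \<in> elems M c)))" for c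
    unfolding finset_codes_def using elems_less N.less_trans by blast
  then show ?thesis
    by (simp only:) (intro rec_intros assms recf_comp[OF assms])
qed

end

section \<open>Codes of finite sequences and primitive recursion\<close>

context rca0
begin

abbreviation entry :: "'a \<Rightarrow> 'a \<Rightarrow> 'a \<Rightarrow> bool" where
  "entry s i j \<equiv> pr i j \<in> elems M s"

lemma entry_less: "entry s i j \<Longrightarrow> i \<sqsubset> s" "entry s i j \<Longrightarrow> j \<sqsubset> s"
  using elems_less N.le_less_trans leq_pr1 leq_pr2 by blast+

lemma seq_len_eqI:
  assumes "\<And>i. i \<sqsubset> l \<longleftrightarrow> (\<exists>j. entry s i j)" shows "seq_len M s = l"
  unfolding seq_len_def
proof (rule the_equality)
  fix l' assume "\<forall>i. i \<sqsubset> l' \<longleftrightarrow> (\<exists>j. entry s i j)"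
  with assms have "\<And>i. i \<sqsubset> l' \<longleftrightarrow> i \<sqsubset> l" by simp
  then show "l' = l"
    using N.less_irrefl N.less_linear by blast
qed (use assms in blast)

lemma seqs_len: "s \<in> seqs M \<Longrightarrow> i \<sqsubset> seq_len M s \<longleftrightarrow> (\<exists>j. entry s i j)"
  unfolding seqs_def using seq_len_eqI by blast

lemma seqs_nth: "s \<in> seqs M \<Longrightarrow> entry s i j \<longleftrightarrow> i \<sqsubset> seq_len M s \<and> j = seq_nth M s i"
proof -
  assume s: "s \<in> seqs M"
  then have unique: "entry s i j \<Longrightarrow> entry s i j' \<Longrightarrow> j = j'" for j j'
    unfolding seqs_def by blast
  then have "entry s i j \<Longrightarrow> seq_nth M s i = j" for j
    unfolding seq_nth_def by blast
  then show ?thesis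
    using seqs_len[OF s] by blast
qed

lemma seqs_eqI:
  assumes "s \<in> seqs M" "t \<in> seqs M" "seq_len M s = seq_len M t"
    and "\<And>i. i \<sqsubset> seq_len M s \<Longrightarrow> seq_nth M s i = seq_nth M t i"
  shows "s = t"
proof (rule finset_code_unique)
  have "z \<in> elems M s \<longleftrightarrow> (\<exists>i j. z = pr i j \<and> i \<sqsubset> seq_len M s \<and> j = seq_nth M s i)" if "s \<in> seqs M" for z s
  proof -
    have "\<forall>x\<in>elems M s. \<exists>i j. x = pr i j"
      using that by (simp add: seqs_def)
    then have "z \<in> elems M s \<longleftrightarrow> (\<exists>i j. z = pr i j \<and> entry s i j)"
      by auto
    then show ?thesis
      by (simp add: seqs_nth[OF that])
  qed
  then show "elems M s = elems M t"
    using assms by auto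
qed (use assms in \<open>auto simp: seqs_def\<close>)

text \<open>The graph lies below \<open>pr l b\<close>, since smaller entries give a smaller sum.
  The resulting bound depends only on length and range of values, so it bounds all strings of a
  given length at once.\<close>

lemma seq_ex_bounded:
  assumes "recf f" "\<And>i. i \<sqsubset> l \<Longrightarrow> f i \<sqsubset> b"
  obtains s where "s \<in> seqs M" "seq_len M s = l" "\<And>i. i \<sqsubset> l \<Longrightarrow> seq_nth M s i = f i"
    "s \<sqsubseteq> code_bound (pr l b)"
proof -
  have "recp (\<lambda>z. \<exists>i. i \<sqsubset> l \<and> z = pr i (f i))"
    by (intro rec_intros recf_comp[OF assms(1)])
  moreover have "z \<sqsubset> pr l b" if "\<exists>i. i \<sqsubset> l \<and> z = pr i (f i)" for z
    using that assms(2) by (auto intro!: pr_mono_sum N.add_strict_mono)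
  ultimately obtain s where s: "s \<in> finset_codes M" "elems M s = {z. \<exists>i. i \<sqsubset> l \<and> z = pr i (f i)}"
    "s \<sqsubseteq> code_bound (pr l b)"
    using finset_code_ex by blast
  have "s \<in> seqs M"
    using s(1) by (auto simp: seqs_def s(2))
  moreover have len: "seq_len M s = l"
    by (rule seq_len_eqI) (simp add: s(2))
  moreover have "seq_nth M s i = f i" if "i \<sqsubset> l" for i
    using seqs_nth[OF \<open>s \<in> seqs M\<close>, of i "f i"] that by (simp add: s(2))
  ultimately show thesis using that s(3) by blast
qed

text \<open>Bounding for a recursive function: the condition on \<open>b\<close> is recursive, so
  existence of a bound can be proved by \<Sigma>1 induction on \<open>l\<close>.\<close>

lemma ex_bound:
  assumes "recf f" shows "\<exists>b. \<forall>i. i \<sqsubset> l \<longrightarrow> f i \<sqsubset> b"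
proof (rule sigma1_induct[of "\<lambda>l b. \<forall>i. i \<sqsubset> l \<longrightarrow> f i \<sqsubset> b"])
  show "recp2 (\<lambda>l b. \<forall>i. i \<sqsubset> l \<longrightarrow> f i \<sqsubset> b)"
    unfolding recp2_def by (intro rec_intros recf_comp[OF assms])
  fix l assume "\<exists>b. \<forall>i. i \<sqsubset> l \<longrightarrow> f i \<sqsubset> b"
  then obtain b where b: "\<And>i. i \<sqsubset> l \<Longrightarrow> f i \<sqsubset> b" by blast
  have "f i \<sqsubset> b \<oplus> f l \<oplus> \<one>" if "i \<sqsubset> l \<oplus> \<one>" for i
  proof -
    have "b \<sqsubseteq> b \<oplus> f l" "f l \<sqsubseteq> b \<oplus> f l" by simp_all
    with b[of i] that show ?thesis
      unfolding less_succ_iff by (auto simp: leq_def intro: N.less_trans)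
  qed
  then show "\<exists>b. \<forall>i. i \<sqsubset> l \<oplus> \<one> \<longrightarrow> f i \<sqsubset> b" by blast
qed simp

lemma seq_ex:
  assumes "recf f"
  obtains s where "s \<in> seqs M" "seq_len M s = l" "\<And>i. i \<sqsubset> l \<Longrightarrow> seq_nth M s i = f i"
  using seq_ex_bounded[OF assms] ex_bound[OF assms] by metis

section \<open>Recursive length and entry functions\<close>

text \<open>Total recursive versions of \<open>seq_len\<close> and \<open>seq_nth\<close>, agreeing
  with them on sequences. In \<open>snth\<close> the default \<open>s\<close> makes the search
  succeed; genuine entries are smaller than \<open>s\<close>, so it never hides one.\<close>

definition slen :: "'a \<Rightarrow> 'a" where
  "slen s = least (\<lambda>l. \<not> (\<exists>j. j \<sqsubset> s \<and> entry s l j))"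
definition snth :: "'a \<Rightarrow> 'a \<Rightarrow> 'a" where
  "snth s i = least (\<lambda>j. entry s i j \<or> j = s)"

lemma recf_slen_fun: "recf slen"
  unfolding slen_def
  by (intro recf_least) (use entry_less in \<open>auto simp: recp2_def intro!: rec_intros\<close>)

lemma recf2_snth: "recf2 snth"
  unfolding snth_def recf2_def
  by (intro recf_least) (auto simp: recp2_def intro!: rec_intros)

lemmas recf_slen [rec_intros] = recf_comp[OF recf_slen_fun]
lemmas recf_snth [rec_intros] = recf2_comp[OF recf2_snth]

lemma seqs_slen: "s \<in> seqs M \<Longrightarrow> slen s = seq_len M s"
  unfolding slen_def
  by (rule least_eqI) (use seqs_len entry_less N.less_irrefl in blast)+

lemma seqs_snth:
  assumes "s \<in> seqs M" "i \<sqsubset> seq_len M s" shows "snth s i = seq_nth M s i"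
  unfolding snth_def
proof (rule least_eqI)
  have *: "entry s i j \<longleftrightarrow> j = seq_nth M s i" for j
    using seqs_nth[OF assms(1)] assms(2) by simp
  then show "entry s i (seq_nth M s i) \<or> seq_nth M s i = s" by simp
  then show "\<not> (entry s i j \<or> j = s)" if "j \<sqsubset> seq_nth M s i" for j
    using that * entry_less(2)[OF *[THEN iffD2, OF refl]] by auto
qed

text \<open>Every quantifier in \<open>seqs\<close> can be bounded by the code \<open>s\<close>:
  indices and entries lie below it, and the only candidate for the length is
  \<open>slen s\<close>.\<close>

lemma recp_seqs [rec_intros]:
  assumes "recf f" shows "recp (\<lambda>x. f x \<in> seqs M)"
proof -
  have len_iff: "(\<exists>l. \<forall>i. i \<sqsubset> l \<longleftrightarrow> (\<exists>j. entry s i j)) \<longleftrightarrow>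
      slen s \<sqsubseteq> s \<and> (\<forall>i. i \<sqsubset> s \<longrightarrow> (i \<sqsubset> slen s \<longleftrightarrow> (\<exists>j. j \<sqsubset> s \<and> entry s i j)))" (is "?l \<longleftrightarrow> ?r") for s
  proof
    assume ?l
    then obtain l where l: "\<And>i. i \<sqsubset> l \<longleftrightarrow> (\<exists>j. entry s i j)" by blast
    then have "slen s = l"
      unfolding slen_def
      by (intro least_eqI) (use entry_less N.less_irrefl in blast)+
    moreover have "l \<sqsubseteq> s"
      using l[of s] entry_less N.less_irrefl N.not_less by blast
    ultimately show ?r
      using l entry_less by blast
  next
    assume ?r
    then show ?l
      using entry_less N.less_le_trans by (intro exI[of _ "slen s"]) blast
  qed
  have "s \<in> seqs M \<longleftrightarrow> s \<in> finset_codes M \<and> (\<forall>x. x \<sqsubset> s \<longrightarrow> x \<in> elems M s \<longrightarrow> x = pr (pfst x) (psnd x)) \<and>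
     (\<forall>i. i \<sqsubset> s \<longrightarrow> (\<forall>j. j \<sqsubset> s \<longrightarrow> (\<forall>j'. j' \<sqsubset> s \<longrightarrow> entry s i j \<longrightarrow> entry s i j' \<longrightarrow> j = j'))) \<and>
     slen s \<sqsubseteq> s \<and> (\<forall>i. i \<sqsubset> s \<longrightarrow> (i \<sqsubset> slen s \<longleftrightarrow> (\<exists>j. j \<sqsubset> s \<and> entry s i j)))" for s
  proof -
    have "(\<forall>x\<in>elems M s. \<exists>i j. x = pr i j) \<longleftrightarrow> (\<forall>x. x \<sqsubset> s \<longrightarrow> x \<in> elems M s \<longrightarrow> x = pr (pfst x) (psnd x))"
      using elems_less by (metis pfst_pr psnd_pr)
    moreover have "(\<forall>i j j'. entry s i j \<longrightarrow> entry s i j' \<longrightarrow> j = j') \<longleftrightarrow>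
      (\<forall>i. i \<sqsubset> s \<longrightarrow> (\<forall>j. j \<sqsubset> s \<longrightarrow> (\<forall>j'. j' \<sqsubset> s \<longrightarrow> entry s i j \<longrightarrow> entry s i j' \<longrightarrow> j = j')))"
      using entry_less by blast
    ultimately show ?thesis
      unfolding seqs_def len_iff by simp
  qed
  then show ?thesis
    by (simp only:) (intro rec_intros assms recf_comp[OF assms])
qed

text \<open>\<open>Q n s\<close> says that \<open>s\<close> records the values at
  \<open>0, ..., n\<close>. Such an \<open>s\<close> exists by \<Sigma>1 induction, and choosing the
  least one makes the function recursive.\<close>

lemma prim_rec:
  assumes "recf2 g"
  obtains f where "recf f" "f \<zero> = a" "\<And>n. f (n \<oplus> \<one>) = g n (f n)"
proof -
  define Q where "Q n s \<longleftrightarrow> s \<in> seqs M \<and> slen s = n \<oplus> \<one> \<and> snth s \<zero> = a \<and>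
    (\<forall>i. i \<sqsubset> n \<longrightarrow> snth s (i \<oplus> \<one>) = g i (snth s i))" for n s
  have recQ: "recp2 Q"
    unfolding recp2_def Q_def by (intro rec_intros recf2_comp[OF assms])
  have ex: "\<exists>s. Q n s" for n
  proof (rule sigma1_induct[OF recQ])
    obtain s where "s \<in> seqs M" "seq_len M s = \<one>" "\<And>i. i \<sqsubset> \<one> \<Longrightarrow> seq_nth M s i = a"
      using seq_ex[OF recf_const] by blast
    then have "Q \<zero> s"
      by (simp add: Q_def seqs_slen seqs_snth)
    then show "\<exists>s. Q \<zero> s" ..
    fix n assume "\<exists>s. Q n s"
    then obtain s where s: "Q n s" ..
    let ?f = "\<lambda>i. if i \<sqsubset> n \<oplus> \<one> then snth s i else g n (snth s n)"
    have "recf ?f"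
      by (intro rec_intros recf2_comp[OF assms])
    then obtain t where t: "t \<in> seqs M" "seq_len M t = n \<oplus> \<one> \<oplus> \<one>"
      "\<And>i. i \<sqsubset> n \<oplus> \<one> \<oplus> \<one> \<Longrightarrow> seq_nth M t i = ?f i"
      using seq_ex[of ?f] by blast
    then have t': "snth t i = ?f i" if "i \<sqsubset> n \<oplus> \<one> \<oplus> \<one>" for i
      using that by (simp add: seqs_snth)
    have "snth t (i \<oplus> \<one>) = g i (snth t i)" if "i \<sqsubset> n \<oplus> \<one>" for i
    proof (cases "i = n")
      case False
      with that have "i \<sqsubset> n" by (simp add: lt_succ)
      moreover from this have "i \<oplus> \<one> \<sqsubset> n \<oplus> \<one>"
        by simp
      ultimately show ?thesis
        using s that t'[of i] t'[of "i \<oplus> \<one>"] by (simp add: Q_def lt_succ)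
    qed (use t'[of n] t'[of "n \<oplus> \<one>"] in \<open>simp add: lt_succ\<close>)
    then have "Q (n \<oplus> \<one>) t"
      using t t'[of \<zero>] s unfolding Q_def by (simp add: seqs_slen less_succ_iff)
    then show "\<exists>t. Q (n \<oplus> \<one>) t" ..
  qed
  \<comment> \<open>Two computations of different length are compared because the values at
    \<open>n\<close> and \<open>n + 1\<close> are read from different sequences.\<close>
  have unique: "snth s i = snth s' i" if "Q n s" "Q n' s'" "i \<sqsubseteq> n" "i \<sqsubseteq> n'" for n s n' s' i
  proof -
    have "i \<sqsubseteq> n \<longrightarrow> i \<sqsubseteq> n' \<longrightarrow> snth s i = snth s' i"
    proof (rule rec_induct[of "\<lambda>i. i \<sqsubseteq> n \<longrightarrow> i \<sqsubseteq> n' \<longrightarrow> snth s i = snth s' i"])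
      show "recp (\<lambda>i. i \<sqsubseteq> n \<longrightarrow> i \<sqsubseteq> n' \<longrightarrow> snth s i = snth s' i)"
        by (intro rec_intros)
      show "\<zero> \<sqsubseteq> n \<longrightarrow> \<zero> \<sqsubseteq> n' \<longrightarrow> snth s \<zero> = snth s' \<zero>"
        using that by (simp add: Q_def)
      fix i assume IH: "i \<sqsubseteq> n \<longrightarrow> i \<sqsubseteq> n' \<longrightarrow> snth s i = snth s' i"
      show "i \<oplus> \<one> \<sqsubseteq> n \<longrightarrow> i \<oplus> \<one> \<sqsubseteq> n' \<longrightarrow> snth s (i \<oplus> \<one>) = snth s' (i \<oplus> \<one>)"
      proof (intro impI)
        assume "i \<oplus> \<one> \<sqsubseteq> n" "i \<oplus> \<one> \<sqsubseteq> n'"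
        then have "i \<sqsubset> n" "i \<sqsubset> n'" by (simp_all only: succ_leq_iff)
        with IH that(1,2) show "snth s (i \<oplus> \<one>) = snth s' (i \<oplus> \<one>)"
          by (simp add: Q_def leq_def)
      qed
    qed
    then show ?thesis using that by blast
  qed
  define f where "f n = snth (least (Q n)) n" for n
  have Q: "Q n (least (Q n))" for n
    using least(1)[OF recp2_arg[OF recQ]] ex by blast
  show thesis
  proof
    show "recf f"
      unfolding f_def by (intro recf_snth recf_id recf_least[OF recQ ex])
    show "f \<zero> = a"
      using Q by (simp add: f_def Q_def)
    show "f (n \<oplus> \<one>) = g n (f n)" for n
      using unique[OF Q Q, of n n "n \<oplus> \<one>"] Q[of "n \<oplus> \<one>"] by (simp add: f_def Q_def lt_succ leq_def)
  qed
qed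

end

section \<open>Partitions and strings\<close>

context rca0
begin

lemma minimum_eqI: "m \<in> A \<Longrightarrow> (\<And>a. a \<in> A \<Longrightarrow> m \<sqsubseteq> a) \<Longrightarrow> minimum M A = m"
  unfolding minimum_def leq_def using N.less_asym by (intro the_equality) blast+

lemma minimum:
  assumes "recp P" "P a"
  shows "P (minimum M {a. P a})" "\<And>a. P a \<Longrightarrow> minimum M {a. P a} \<sqsubseteq> a"
proof -
  have "minimum M {a. P a} = least P"
    using least[OF assms] by (intro minimum_eqI) auto
  then show "P (minimum M {a. P a})" "\<And>a. P a \<Longrightarrow> minimum M {a. P a} \<sqsubseteq> a"
    using least[OF assms] by auto
qed

text \<open>Comparing minima of blocks amounts to finding, before each element of the later block,
  one of the earlier block. The hypothesis guarantees that blocks have least elements inside the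
  model.\<close>

lemma ordered_surj_iff:
  assumes "\<And>i. recp (\<lambda>a. a \<in> A \<and> p a = i)"
  shows "ordered_surj M A B p \<longleftrightarrow> p ` A = B \<and>
    (\<forall>i\<in>B. \<forall>j\<in>B. i \<sqsubset> j \<longrightarrow> (\<forall>b\<in>A. p b = j \<longrightarrow> (\<exists>a\<in>A. a \<sqsubset> b \<and> p a = i)))"
proof (cases "p ` A = B")
  case True
  let ?m = "\<lambda>i. minimum M {a. a \<in> A \<and> p a = i}"
  have m: "?m i \<in> A" "p (?m i) = i" "\<And>a. a \<in> A \<Longrightarrow> p a = i \<Longrightarrow> ?m i \<sqsubseteq> a" if "i \<in> B" for i
    using minimum[OF assms, of _ i] that True by blast+
  have "?m i \<sqsubset> ?m j \<longleftrightarrow> (\<forall>b\<in>A. p b = j \<longrightarrow> (\<exists>a\<in>A. a \<sqsubset> b \<and> p a = i))" if ij: "i \<in> B" "j \<in> B" for i j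
  proof
    assume "?m i \<sqsubset> ?m j"
    then show "\<forall>b\<in>A. p b = j \<longrightarrow> (\<exists>a\<in>A. a \<sqsubset> b \<and> p a = i)"
      using m[OF ij(1)] m[OF ij(2)] N.less_le_trans by blast
  next
    assume "\<forall>b\<in>A. p b = j \<longrightarrow> (\<exists>a\<in>A. a \<sqsubset> b \<and> p a = i)"
    then obtain a where "a \<in> A" "a \<sqsubset> ?m j" "p a = i"
      using m[OF ij(2)] by blast
    then show "?m i \<sqsubset> ?m j"
      using m(3)[OF ij(1)] N.le_less_trans by blast
  qed
  with True show ?thesis
    unfolding ordered_surj_def by simp
qed (simp add: ordered_surj_def)

lemma partitions_iff:
  "p \<in> partitions M B \<longleftrightarrow> recf p \<and> range p = B \<and>
    (\<forall>j\<in>B. \<forall>i\<in>B. i \<sqsubset> j \<longrightarrow> (\<forall>b. p b = j \<longrightarrow> (\<exists>a. a \<sqsubset> b \<and> p a = i)))"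
proof -
  have "p \<in> model_funs M UNIV B \<longleftrightarrow> range p \<subseteq> B \<and> recf p"
    by (simp add: model_funs_def recf_def)
  moreover have "ordered_surj M UNIV B p \<Longrightarrow> range p \<subseteq> B"
    by (simp add: ordered_surj_def)
  ultimately have "p \<in> partitions M B \<longleftrightarrow> recf p \<and> ordered_surj M UNIV B p"
    by (auto simp: partitions_def)
  moreover have "recp (\<lambda>a. a \<in> UNIV \<and> p a = i)" if "recf p" for i
    by simp (intro rec_intros recf_comp[OF that])
  ultimately show ?thesis
    using ordered_surj_iff[of UNIV p B] by (metis (no_types, lifting) UNIV_I)
qed

lemma partitions_recf: "p \<in> partitions M B \<Longrightarrow> recf p"
  by (simp add: partitions_iff)

lemma partitions_before:
  "p \<in> partitions M B \<Longrightarrow> i \<in> B \<Longrightarrow> i \<sqsubset> p b \<Longrightarrow> \<exists>a. a \<sqsubset> b \<and> p a = i"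
  by (auto simp: partitions_iff)

lemma partitions_comp:
  assumes x: "x \<in> partitions M B" and p: "p \<in> omega_partitions M" shows "x \<circ> p \<in> partitions M B"
proof -
  have "recf (\<lambda>i. x (p i))"
    by (rule recf_comp) (use assms in \<open>simp_all add: partitions_iff\<close>)
  moreover have "range (x \<circ> p) = B"
    using assms unfolding image_comp[symmetric] partitions_iff by simp
  moreover have "\<exists>a. a \<sqsubset> b \<and> x (p a) = i" if i: "i \<in> B" "i \<sqsubset> x (p b)" for i b
    using partitions_before[OF x i] partitions_before[OF p UNIV_I] by blast
  ultimately show ?thesis
    unfolding partitions_iff by (auto simp: comp_def)
qed

section \<open>Ordered surjections between initial segments\<close>

text \<open>The finite case of \<open>ordered_surj\<close>, written with bounded quantifiers only,
  so that it is recursive and may have a nonstandard number \<open>c\<close> of blocks.\<close>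

definition ord_onto :: "'a \<Rightarrow> 'a \<Rightarrow> ('a \<Rightarrow> 'a) \<Rightarrow> bool" where
  "ord_onto l c f \<longleftrightarrow> (\<forall>a. a \<sqsubset> l \<longrightarrow> f a \<sqsubset> c) \<and> (\<forall>i. i \<sqsubset> c \<longrightarrow> (\<exists>a. a \<sqsubset> l \<and> f a = i)) \<and>
    (\<forall>j. j \<sqsubset> c \<longrightarrow> (\<forall>i. i \<sqsubset> j \<longrightarrow> (\<forall>b. b \<sqsubset> l \<longrightarrow> f b = j \<longrightarrow> (\<exists>a. a \<sqsubset> b \<and> f a = i))))"

lemma ord_ontoI:
  assumes "\<And>a. a \<sqsubset> l \<Longrightarrow> f a \<sqsubset> c" "\<And>i. i \<sqsubset> c \<Longrightarrow> \<exists>a. a \<sqsubset> l \<and> f a = i"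
    and "\<And>b i. b \<sqsubset> l \<Longrightarrow> i \<sqsubset> f b \<Longrightarrow> \<exists>a. a \<sqsubset> b \<and> f a = i"
  shows "ord_onto l c f"
  unfolding ord_onto_def using assms by simp

lemma ord_ontoD:
  assumes "ord_onto l c f"
  shows "a \<sqsubset> l \<Longrightarrow> f a \<sqsubset> c" "i \<sqsubset> c \<Longrightarrow> \<exists>a. a \<sqsubset> l \<and> f a = i"
    "a \<sqsubset> l \<Longrightarrow> i \<sqsubset> f a \<Longrightarrow> \<exists>a'. a' \<sqsubset> a \<and> f a' = i"
  using assms unfolding ord_onto_def by blast+

lemma ord_onto_cong:
  assumes "\<And>a. a \<sqsubset> l \<Longrightarrow> f a = g a" shows "ord_onto l c f \<longleftrightarrow> ord_onto l c g"
proof -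
  have "ord_onto l c g" if f: "ord_onto l c f" and eq: "\<And>a. a \<sqsubset> l \<Longrightarrow> f a = g a" for f g
  proof (rule ord_ontoI)
    show "g a \<sqsubset> c" if "a \<sqsubset> l" for a
      using ord_ontoD(1)[OF f that] eq[OF that] by simp
    show "\<exists>a. a \<sqsubset> l \<and> g a = i" if "i \<sqsubset> c" for i
      using ord_ontoD(2)[OF f that] eq by auto
    fix b i assume b: "b \<sqsubset> l" "i \<sqsubset> g b"
    then obtain a where "a \<sqsubset> b" "f a = i"
      using ord_ontoD(3)[OF f, of b i] eq by auto
    with b eq[of a] show "\<exists>a. a \<sqsubset> b \<and> g a = i"
      using N.less_trans by auto
  qed
  from this[of f g] this[of g f] show ?thesis
    using assms by auto
qed

lemma ord_onto_comp:
  assumes z: "ord_onto l c z" and x: "ord_onto c d x" shows "ord_onto l d (\<lambda>i. x (z i))"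
proof (rule ord_ontoI)
  show "x (z a) \<sqsubset> d" if "a \<sqsubset> l" for a
    using ord_ontoD(1)[OF x ord_ontoD(1)[OF z that]] .
  show "\<exists>a. a \<sqsubset> l \<and> x (z a) = i" if "i \<sqsubset> d" for i
    using ord_ontoD(2)[OF x that] ord_ontoD(2)[OF z] by blast
  fix b i assume b: "b \<sqsubset> l" "i \<sqsubset> x (z b)"
  then obtain a where "a \<sqsubset> z b" "x a = i"
    using ord_ontoD(3)[OF x ord_ontoD(1)[OF z b(1)]] by blast
  then show "\<exists>a. a \<sqsubset> b \<and> x (z a) = i"
    using ord_ontoD(3)[OF z b(1)] by blast
qed

lemma ordered_surj_below_iff:
  assumes "\<And>i. recp (\<lambda>a. a \<sqsubset> l \<and> f a = i)"
  shows "ordered_surj M (below M l) (below M c) f \<longleftrightarrow> ord_onto l c f"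
proof -
  have "ordered_surj M (below M l) (below M c) f \<longleftrightarrow> f ` below M l = below M c \<and>
    (\<forall>i\<in>below M c. \<forall>j\<in>below M c. i \<sqsubset> j \<longrightarrow>
      (\<forall>b\<in>below M l. f b = j \<longrightarrow> (\<exists>a\<in>below M l. a \<sqsubset> b \<and> f a = i)))"
    by (rule ordered_surj_iff) (use assms in \<open>simp add: below_def\<close>)
  also have "\<dots> \<longleftrightarrow> ord_onto l c f"
  proof
    assume *: "ord_onto l c f"
    have "\<exists>a\<in>below M l. a \<sqsubset> b \<and> f a = i" if "b \<in> below M l" "i \<sqsubset> f b" for b i
      using ord_ontoD(3)[OF *, of b i] that N.less_trans[of _ b l] by (auto simp: below_def)
    then show "f ` below M l = below M c \<and> (\<forall>i\<in>below M c. \<forall>j\<in>below M c. i \<sqsubset> j \<longrightarrow>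
      (\<forall>b\<in>below M l. f b = j \<longrightarrow> (\<exists>a\<in>below M l. a \<sqsubset> b \<and> f a = i)))"
      using ord_ontoD(1,2)[OF *] unfolding below_def by blast
  next
    assume *: "f ` below M l = below M c \<and> (\<forall>i\<in>below M c. \<forall>j\<in>below M c. i \<sqsubset> j \<longrightarrow>
      (\<forall>b\<in>below M l. f b = j \<longrightarrow> (\<exists>a\<in>below M l. a \<sqsubset> b \<and> f a = i)))"
    show "ord_onto l c f"
    proof (rule ord_ontoI)
      show less: "f a \<sqsubset> c" if "a \<sqsubset> l" for a
        using * that by (auto simp: below_def)
      show "\<exists>a. a \<sqsubset> l \<and> f a = i" if "i \<sqsubset> c" for i
      proof -
        have "i \<in> f ` below M l" using * that by (simp add: below_def)
        then show ?thesis by (auto simp: below_def)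
      qed
      show "\<exists>a. a \<sqsubset> b \<and> f a = i" if "b \<sqsubset> l" "i \<sqsubset> f b" for b i
      proof -
        have "b \<in> below M l" "f b \<in> below M c" "i \<in> below M c"
          using that less[of b] N.less_trans[of i "f b" c] by (simp_all add: below_def)
        then show ?thesis
          using * that(2) by blast
      qed
    qed
  qed
  finally show ?thesis .
qed

lemma strings_iff: "s \<in> strings M k \<longleftrightarrow> s \<in> seqs M \<and> ord_onto (slen s) (num M k) (snth s)"
proof (cases "s \<in> seqs M")
  case True
  let ?l = "seq_len M s"
  have "recp (\<lambda>a. a \<sqsubset> ?l \<and> snth s a = i)" for i
    by (intro rec_intros)
  moreover have "a \<sqsubset> ?l \<and> snth s a = i \<longleftrightarrow> a \<sqsubset> ?l \<and> seq_nth M s a = i" for a i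
    using seqs_snth[OF True, of a] by auto
  ultimately have "ordered_surj M (below M ?l) (below M (num M k)) (seq_nth M s) \<longleftrightarrow>
    ord_onto ?l (num M k) (seq_nth M s)"
    by (intro ordered_surj_below_iff) simp
  then show ?thesis
    using True seqs_snth[OF True] ord_onto_cong[of ?l "snth s"] by (simp add: strings_def seqs_slen)
qed (simp add: strings_def)

lemma strings_seqs: "s \<in> strings M k \<Longrightarrow> s \<in> seqs M"
  by (simp add: strings_iff)

lemma recp_ord_onto:
  assumes "recf l" "recf c" "recf2 f" "recf g"
  shows "recp (\<lambda>x. ord_onto (l x) (c x) (f (g x)))"
  unfolding ord_onto_def
  by (intro rec_intros recf2_comp[OF assms(3)] recf_comp[OF assms(1)] recf_comp[OF assms(2)]
      recf_comp[OF assms(4)] assms(1))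

lemma recp_strings [rec_intros]: "recf f \<Longrightarrow> recp (\<lambda>x. f x \<in> strings M k)"
  unfolding strings_iff by (intro rec_intros recp_ord_onto recf2_snth)

lemma restriction:
  assumes "recf f"
  shows "restriction M f m \<in> seqs M" "slen (restriction M f m) = m"
    "\<And>i. i \<sqsubset> m \<Longrightarrow> snth (restriction M f m) i = f i"
proof -
  obtain s where s: "s \<in> seqs M" "seq_len M s = m" "\<And>i. i \<sqsubset> m \<Longrightarrow> seq_nth M s i = f i"
    using seq_ex[OF assms] by blast
  have "restriction M f m = s"
    unfolding restriction_def
  proof (rule the_equality)
    fix t assume t: "t \<in> seqs M \<and> seq_len M t = m \<and> initial_seg M t f"
    show "t = s"
    proof (rule seqs_eqI)
      show "seq_nth M t i = seq_nth M s i" if "i \<sqsubset> seq_len M t" for i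
        using t s(3)[of i] that by (simp add: initial_seg_def)
    qed (use s(1,2) t in auto)
  qed (simp add: initial_seg_def s)
  then show "restriction M f m \<in> seqs M" "slen (restriction M f m) = m"
    "\<And>i. i \<sqsubset> m \<Longrightarrow> snth (restriction M f m) i = f i"
    using s by (auto simp: seqs_slen seqs_snth)
qed

lemma seqs_snth_eqI:
  assumes "s \<in> seqs M" "t \<in> seqs M" "slen s = slen t" "\<And>i. i \<sqsubset> slen s \<Longrightarrow> snth s i = snth t i"
  shows "s = t"
proof (rule seqs_eqI)
  show len: "seq_len M s = seq_len M t"
    using assms(1-3) by (simp add: seqs_slen)
  show "seq_nth M s i = seq_nth M t i" if "i \<sqsubset> seq_len M s" for i
    using assms(4)[of i] that assms(1,2) len by (simp add: seqs_slen seqs_snth)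
qed (fact assms)+

lemma initial_seg_iff: "s \<in> seqs M \<Longrightarrow> initial_seg M s p \<longleftrightarrow> (\<forall>i. i \<sqsubset> slen s \<longrightarrow> snth s i = p i)"
  by (simp add: initial_seg_def seqs_slen seqs_snth)

lemma cylinder_iff:
  "s \<in> strings M k \<Longrightarrow> p \<in> cylinder M k s \<longleftrightarrow> p \<in> k_partitions M k \<and> (\<forall>i. i \<sqsubset> slen s \<longrightarrow> snth s i = p i)"
  unfolding cylinder_def by (auto simp: initial_seg_iff strings_seqs)

text \<open>Beyond \<open>l\<close> the value is zero, below which there is no block, so the
  ordering condition has content only below \<open>l\<close>.\<close>

lemma k_partitions_ord_onto:
  assumes "ord_onto l (num M k) p" "recf p" "\<And>a. p a \<sqsubset> num M k" "\<And>a. l \<sqsubseteq> a \<Longrightarrow> p a = \<zero>"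
  shows "p \<in> k_partitions M k"
proof -
  have "range p = below M (num M k)"
    using assms(1,3) by (auto simp: ord_onto_def below_def)
  moreover have "\<exists>a. a \<sqsubset> b \<and> p a = i" if "p b \<sqsubset> num M k" "i \<sqsubset> p b" for b i
  proof -
    have "b \<sqsubset> l" using assms(4)[of b] that by (auto simp flip: N.not_le)
    then show ?thesis
      using ord_ontoD(3)[OF assms(1)] that by blast
  qed
  ultimately show ?thesis
    unfolding partitions_iff using assms(2) by (auto simp: below_def)
qed

text \<open>The string is continued by putting all further numbers into block 0, which exists
  because \<open>k > 0\<close>.\<close>

lemma cylinder_nonempty:
  assumes "t \<in> strings M k" "k > 0" shows "cylinder M k t \<noteq> {}"
proof -
  let ?p = "\<lambda>i. if i \<sqsubset> slen t then snth t i else \<zero>"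
  have "ord_onto (slen t) (num M k) ?p"
    using assms(1) ord_onto_cong[of "slen t" ?p "snth t"] by (simp add: strings_iff)
  moreover have "recf ?p" by (intro rec_intros)
  moreover have "?p a \<sqsubset> num M k" for a
    using assms by (auto simp: strings_iff ord_onto_def num_pos zero_lt_iff)
  ultimately have "?p \<in> k_partitions M k"
    by (intro k_partitions_ord_onto) (auto simp: N.not_less[symmetric])
  then have "?p \<in> cylinder M k t"
    using assms(1) by (simp add: cylinder_iff)
  then show ?thesis by blast
qed

section \<open>The start of the last block and the string it determines\<close>

lemma block_min:
  assumes "recf p" "p a = i"
  shows "p (block_min M p i) = i" "b \<sqsubset> block_min M p i \<Longrightarrow> p b \<noteq> i"
proof -
  have "recp (\<lambda>a. p a = i)" by (intro rec_intros recf_comp[OF assms(1)])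
  from minimum[OF this assms(2)]
  show "p (block_min M p i) = i" "b \<sqsubset> block_min M p i \<Longrightarrow> p b \<noteq> i"
    by (auto simp: block_min_def N.not_less[symmetric])
qed

text \<open>The ordering condition at \<open>m\<close> places an element of every earlier block
  before \<open>m\<close>, while the last block begins at \<open>m\<close> itself. So restricting to
  \<open>m\<close> loses exactly one block and restricting further loses none.\<close>

lemma k_partitions_block_min:
  assumes "p \<in> k_partitions M k" "k > 0"
  defines "m \<equiv> block_min M p (num M (k - 1))"
  shows "p m = num M (k - 1)" "\<And>a. a \<sqsubset> m \<Longrightarrow> p a \<sqsubset> num M (k - 1)"
    "ord_onto m (num M (k - 1)) p" "\<And>l. m \<sqsubset> l \<Longrightarrow> ord_onto l (num M k) p"
proof -
  let ?K = "num M (k - 1)"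
  have p: "recf p" "range p = {x. x \<sqsubset> ?K \<oplus> \<one>}"
    using assms(1) num_pos[OF assms(2)] by (simp_all add: partitions_iff below_def)
  have p_before: "\<exists>a. a \<sqsubset> b \<and> p a = i" if "i \<sqsubset> p b" for b i
  proof -
    have "p b \<sqsubset> ?K \<oplus> \<one>" using p(2) by auto
    from N.less_trans[OF that this] have "i \<in> below M (num M k)"
      by (simp add: below_def num_pos[OF assms(2)])
    then show ?thesis
      using partitions_before[OF assms(1)] that by blast
  qed
  have "?K \<in> range p"
    unfolding p(2) by (simp add: lt_succ)
  then obtain a where "p a = ?K"
    by auto
  from block_min[OF p(1) this]
  show m: "p m = ?K" and less: "\<And>a. a \<sqsubset> m \<Longrightarrow> p a \<sqsubset> ?K"
    using p(2) unfolding m_def lt_succ by blast+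
  show "ord_onto m ?K p"
  proof (rule ord_ontoI)
    show "\<exists>a. a \<sqsubset> m \<and> p a = i" if "i \<sqsubset> ?K" for i
      using p_before[of i m] m that by simp
  qed (rule less p_before; assumption)+
  show "ord_onto l (num M k) p" if l: "m \<sqsubset> l" for l
    unfolding num_pos[OF assms(2)]
  proof (rule ord_ontoI)
    show "p a \<sqsubset> ?K \<oplus> \<one>" for a
      using p(2) by auto
    show "\<exists>a. a \<sqsubset> l \<and> p a = i" if i: "i \<sqsubset> ?K \<oplus> \<one>" for i
    proof (cases "i = ?K")
      case False
      then show ?thesis
        using p_before[of i m] m i l N.less_trans by (auto simp: lt_succ)
    qed (use m l in blast)
  qed (rule p_before)
qed

lemma star:
  assumes "p \<in> k_partitions M k" "k > 0"
  shows "star M k p \<in> strings M (k - 1)" "slen (star M k p) = block_min M p (num M (k - 1))"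
    "a \<sqsubset> slen (star M k p) \<Longrightarrow> snth (star M k p) a = p a"
proof -
  let ?m = "block_min M p (num M (k - 1))"
  note r = restriction[OF partitions_recf[OF assms(1)], where m = ?m]
  then show "slen (star M k p) = ?m" "a \<sqsubset> slen (star M k p) \<Longrightarrow> snth (star M k p) a = p a"
    by (auto simp: star_def)
  show "star M k p \<in> strings M (k - 1)"
    using k_partitions_block_min(3)[OF assms] r ord_onto_cong[of ?m p "snth (restriction M p ?m)"]
    by (auto simp: star_def strings_iff)
qed

lemma restriction_strings:
  assumes "p \<in> k_partitions M k" "k > 0" "block_min M p (num M (k - 1)) \<sqsubset> l"
  shows "restriction M p l \<in> strings M k"
  using k_partitions_block_min(4)[OF assms] restriction[OF partitions_recf[OF assms(1)], where m = l]
    ord_onto_cong[of l p "snth (restriction M p l)"]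
  by (auto simp: strings_iff)

text \<open>All values of \<open>t\<close> are below the last block, so the value of
  \<open>p\<close> at \<open>slen t\<close> marks where that block starts.\<close>

lemma star_eqI:
  assumes "p \<in> k_partitions M k" "k > 0" "t \<in> strings M (k - 1)"
    and "p (slen t) = num M (k - 1)" "\<And>a. a \<sqsubset> slen t \<Longrightarrow> snth t a = p a"
  shows "star M k p = t"
proof (rule seqs_snth_eqI)
  have "p a \<noteq> num M (k - 1)" if "a \<sqsubset> slen t" for a
    using assms(3,5) that by (auto simp: strings_iff ord_onto_def)
  then have "block_min M p (num M (k - 1)) = slen t"
    using block_min[OF partitions_recf[OF assms(1)] assms(4)] assms(4) N.less_linear by metis
  then show "slen (star M k p) = slen t" using star[OF assms(1,2)] by simp
  then show "snth (star M k p) a = snth t a" if "a \<sqsubset> slen (star M k p)" for a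
    using star(3)[OF assms(1,2)] that assms(5) by simp
qed (use star[OF assms(1,2)] assms(3) strings_seqs in auto)

end

section \<open>From Baire colorings to colorings of strings\<close>

context rca0
begin

lemma coarsenings_k_partitions:
  "p \<in> omega_partitions M \<Longrightarrow> x \<in> coarsenings M p k \<Longrightarrow> x \<in> k_partitions M k"
  unfolding coarsenings_def using partitions_comp by blast

lemma open_set_iff:
  "p \<in> open_set M k V \<longleftrightarrow> p \<in> k_partitions M k \<and>
    (\<exists>n s. s \<in> strings M k \<and> pr n s \<in> V \<and> (\<forall>i. i \<sqsubset> slen s \<longrightarrow> snth s i = p i))"
  unfolding open_set_def using cylinder_iff by blast

text \<open>Every \<open>D n\<close> is taken to be the union \<open>V\<close> of all colors. It is
  a set of the model, being a union over \<open>i\<close> below \<open>l\<close>, and dense since it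
  contains all partitions.\<close>

lemma Baire_DRT_imp_ODRT:
  assumes "Baire_DRT M k l" "k > 0" shows "ODRT M k l"
  unfolding ODRT_def
proof (intro allI impI)
  fix U assume U: "open_coloring M k l U"
  define V where "V = {x. \<exists>i. i \<sqsubset> num M l \<and> pr i x \<in> U}"
  define D where "D = {z. psnd z \<in> V}"
  have "U \<in> set_part M"
    using U by (simp add: open_coloring_def disjoint_open_seq_def)
  then have "recp (\<lambda>x. x \<in> V)" "recp (\<lambda>z. z \<in> D)"
    unfolding D_def V_def mem_Collect_eq by (intro rec_intros; assumption)+
  then have V: "V \<in> set_part M" "D \<in> set_part M"
    by (simp_all add: recp_def)
  have row_D: "row M D n = V" for n
    by (simp add: row_def D_def)
  have V_open: "open_code M k V"
    using U V(1) by (auto simp: open_code_def open_coloring_def disjoint_open_seq_def below_def row_def V_def)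
  have "open_set M k V = (\<Union>i\<in>below M (num M l). open_set M k (row M U i))"
    by (auto simp: open_set_def V_def below_def row_def)
  then have V_all: "open_set M k V = k_partitions M k"
    using U by (simp add: open_coloring_def)
  then have "is_dense M k (open_set M k V)"
    using cylinder_nonempty[OF _ assms(2)] by (auto simp: is_dense_def cylinder_def)
  moreover have "(\<Union>i\<in>below M (num M l). open_set M k (row M U i)) = open_set M k V"
    using U V_all by (simp add: open_coloring_def)
  ultimately have "baire_coloring M k l U D"
    using U V_open V by (simp add: baire_coloring_def row_D open_coloring_def)
  then show "\<exists>p\<in>omega_partitions M. \<exists>i\<in>below M (num M l). \<forall>x\<in>coarsenings M p k. x \<in> open_set M k (row M U i)"
    using assms(1) unfolding Baire_DRT_def by (meson IntD1)
qed

text \<open>Color \<open>i\<close> receives the cylinders of strings that extend some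
  \<open>t\<close> with color \<open>i\<close> followed by the first element of the last block; for
  members of such a cylinder \<open>t\<close> is the string that \<open>c\<close> looks at.\<close>

lemma ODRT_imp_CDRT:
  assumes "ODRT M k l" "k > 0" shows "CDRT M k l"
  unfolding CDRT_def
proof
  let ?K = "num M (k - 1)"
  fix c assume c: "c \<in> model_funs M (strings M (k - 1)) (below M (num M l))"
  \<comment> \<open>Off the strings \<open>c\<close> is arbitrary, so colors are read from this
    graph, which is a set of the model.\<close>
  define C where "C = {pr t (c t) | t. t \<in> strings M (k - 1)}"
  have C: "C \<in> set_part M" "\<And>t. t \<in> strings M (k - 1) \<Longrightarrow> c t \<sqsubset> num M l"
    using c by (auto simp: model_funs_def C_def below_def)
  define P where "P i t s \<longleftrightarrow> s \<in> strings M k \<and> t \<in> strings M (k - 1) \<and> slen t \<sqsubset> slen s \<and>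
      snth s (slen t) = ?K \<and> (\<forall>a. a \<sqsubset> slen t \<longrightarrow> snth s a = snth t a) \<and> pr t i \<in> C" for i t s
  \<comment> \<open>The index component of the code of a basic open set stores the string \<open>p\<^sup>*\<close>.\<close>
  define U where "U = {z. psnd z = pr (pfst (psnd z)) (psnd (psnd z)) \<and>
      P (pfst z) (pfst (psnd z)) (psnd (psnd z))}"
  have row_U: "pr t s \<in> row M U i \<longleftrightarrow> P i t s" for i t s
    by (simp add: row_def U_def)
  have "recp (\<lambda>z. z \<in> U)"
    unfolding U_def P_def mem_Collect_eq by (intro rec_intros C(1))
  then have "U \<in> set_part M"
    by (simp add: recp_def)
  have "open_code M k (row M U i)" for i
  proof -
    have "recp (\<lambda>x. x \<in> row M U i)"
      unfolding row_def mem_Collect_eq by (intro rec_intros \<open>U \<in> set_part M\<close>)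
    moreover have "x \<in> {pr t s | t s. s \<in> strings M k}" if "x \<in> row M U i" for x
      using that by (auto simp: row_def U_def P_def)
    ultimately show ?thesis
      by (auto simp: open_code_def recp_def)
  qed
  have open_iff: "p \<in> open_set M k (row M U i) \<longleftrightarrow> p \<in> k_partitions M k \<and> c (star M k p) = i" for p i
  proof
    assume "p \<in> open_set M k (row M U i)"
    then obtain t s where p: "p \<in> k_partitions M k" and P: "P i t s"
      and s: "\<And>a. a \<sqsubset> slen s \<Longrightarrow> snth s a = p a"
      unfolding open_set_iff row_U by blast
    have "star M k p = t"
    proof (rule star_eqI[OF p assms(2)])
      show "snth t a = p a" if "a \<sqsubset> slen t" for a
        using P s[of a] that N.less_trans[of a "slen t" "slen s"] by (simp add: P_def)
    qed (use P s in \<open>auto simp: P_def\<close>)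
    then show "p \<in> k_partitions M k \<and> c (star M k p) = i"
      using p P by (auto simp: P_def C_def)
  next
    assume p: "p \<in> k_partitions M k \<and> c (star M k p) = i"
    \<comment> \<open>The length is one more than the start of the last block, so that the
      restriction just includes that block.\<close>
    let ?t = "star M k p" and ?s = "restriction M p (block_min M p ?K \<oplus> \<one>)"
    note t = star[OF conjunct1[OF p] assms(2)]
    note s = restriction[OF partitions_recf[OF conjunct1[OF p]], where m = "block_min M p ?K \<oplus> \<one>"]
    have "block_min M p ?K \<sqsubset> block_min M p ?K \<oplus> \<one>"
      by (simp add: lt_succ)
    then have "?s \<in> strings M k"
      using restriction_strings p assms(2) by blast
    moreover have "P i ?t ?s"
      using \<open>?s \<in> strings M k\<close> t s p k_partitions_block_min(1)[OF conjunct1[OF p] assms(2)]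
      by (auto simp: P_def C_def lt_succ)
    moreover have "\<forall>a. a \<sqsubset> slen ?s \<longrightarrow> snth ?s a = p a"
      unfolding s(2) using s(3) by blast
    ultimately show "p \<in> open_set M k (row M U i)"
      unfolding open_set_iff row_U using p by blast
  qed
  have covers: "k_partitions M k = (\<Union>i\<in>below M (num M l). open_set M k (row M U i))"
    using C(2) star(1)[OF _ assms(2)] by (auto simp: open_iff below_def)
  have disjoint: "open_set M k (row M U i) \<inter> open_set M k (row M U j) = {}" if "i \<noteq> j" for i j
    using that by (auto simp: open_iff)
  have "open_coloring M k l U"
    unfolding open_coloring_def disjoint_open_seq_def
    using \<open>U \<in> set_part M\<close> \<open>\<And>i. open_code M k (row M U i)\<close> covers disjoint by blast
  then obtain p i where "p \<in> omega_partitions M" "i \<in> below M (num M l)"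
    "\<forall>x\<in>coarsenings M p k. x \<in> open_set M k (row M U i)"
    using assms(1) unfolding ODRT_def by blast
  then show "\<exists>p\<in>omega_partitions M. \<exists>i\<in>below M (num M l). \<forall>x\<in>coarsenings M p k. c (star M k x) = i"
    unfolding open_iff by blast
qed

end

section \<open>Thinning out to meet dense open sets\<close>

text \<open>One family treats the choice of a color and the sets \<open>D n\<close> alike:
  \<open>W n u s\<close> says that the cylinder of \<open>s\<close> meets requirement
  \<open>n\<close>, with \<open>u\<close> as auxiliary witness. Density is phrased by a common
  member \<open>q\<close> of both cylinders, so no comparison of \<open>s\<close> with
  \<open>t\<close> is made.\<close>

locale dense_requirements = rca0 +
  fixes k :: nat and W :: "'a \<Rightarrow> 'a \<Rightarrow> 'a \<Rightarrow> bool"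
  assumes k_pos: "k > 0"
    and rec_W: "recp (\<lambda>z. W (pfst z) (pfst (psnd z)) (psnd (psnd z)))"
    and W_dense: "t \<in> strings M k \<Longrightarrow>
      \<exists>q u s. q \<in> cylinder M k t \<and> s \<in> strings M k \<and> q \<in> cylinder M k s \<and> W n u s"
begin

lemma recp_W [rec_intros]:
  assumes "recf f" "recf g" "recf h" shows "recp (\<lambda>x. W (f x) (g x) (h x))"
  using recp_comp[OF rec_W recf_pr[OF assms(1) recf_pr[OF assms(2,3)]]] by simp

text \<open>The last clause makes \<open>s\<close> an initial segment of \<open>x\<close> composed
  with \<open>z\<close>, so the requirement holds for every continuation of
  \<open>z\<close>.\<close>

definition meets :: "'a \<Rightarrow> 'a \<Rightarrow> 'a \<Rightarrow> 'a \<Rightarrow> 'a \<Rightarrow> bool" where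
  "meets n x z u s \<longleftrightarrow> W n u s \<and> slen s \<sqsubseteq> slen z \<and>
    (\<forall>a. a \<sqsubset> slen s \<longrightarrow> snth s a = snth x (snth z a))"

text \<open>
  At stage \<open>m\<close>, the number \<open>r = (n, x)\<close> stands for the requirement that the partitions coarsened by
  the string \<open>x\<close> on the first \<open>m + 1\<close> blocks meet the \<open>n\<close>-th dense set.
\<close>

definition req :: "'a \<Rightarrow> 'a \<Rightarrow> bool" where
  "req m r \<longleftrightarrow> pfst r \<sqsubseteq> m \<and> psnd r \<in> strings M k \<and> slen (psnd r) = m \<oplus> \<one>"

text \<open>The number \<open>w\<close> bounds all witnesses, which keeps the predicate recursive;
  only requirements numbered below \<open>j\<close> are considered, so that \<open>j\<close> can
  serve as induction variable.\<close>

definition meets_all :: "'a \<Rightarrow> 'a \<Rightarrow> 'a \<Rightarrow> 'a \<Rightarrow> bool" where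
  "meets_all m z w j \<longleftrightarrow> (\<forall>r. r \<sqsubset> j \<longrightarrow> req m r \<longrightarrow>
    (\<exists>u. u \<sqsubset> w \<and> (\<exists>s. s \<sqsubset> w \<and> meets (pfst r) (psnd r) z u s)))"

text \<open>A finite approximation with blocks \<open>0, ..., m - 1\<close>. Here \<open>m\<close>
  is a number of the model, whereas \<open>strings\<close> takes a standard number of
  blocks.\<close>

definition valid :: "'a \<Rightarrow> 'a \<Rightarrow> bool" where
  "valid m y \<longleftrightarrow> y \<in> seqs M \<and> ord_onto (slen y) m (snth y)"

definition extends :: "'a \<Rightarrow> 'a \<Rightarrow> bool" where
  "extends y z \<longleftrightarrow> slen y \<sqsubseteq> slen z \<and> (\<forall>a. a \<sqsubset> slen y \<longrightarrow> snth z a = snth y a)"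

definition opens :: "'a \<Rightarrow> 'a \<Rightarrow> 'a \<Rightarrow> bool" where
  "opens m y z \<longleftrightarrow> z \<in> seqs M \<and> extends y z \<and> slen y \<sqsubset> slen z \<and> snth z (slen y) = m \<and>
    (\<forall>a. a \<sqsubset> slen z \<longrightarrow> snth z a \<sqsubseteq> m)"

lemma extends_trans: "extends x y \<Longrightarrow> extends y z \<Longrightarrow> extends x z"
  unfolding extends_def using N.less_le_trans N.order_trans by metis

text \<open>All blocks below \<open>m\<close> already occur in \<open>y\<close>, hence before any
  entry added by \<open>z\<close>, and no added entry exceeds \<open>m\<close>.\<close>

lemma valid_opens:
  assumes "valid m y" "opens m y z" shows "valid (m \<oplus> \<one>) z"
proof -
  have y: "ord_onto (slen y) m (snth y)" and z: "z \<in> seqs M" "slen y \<sqsubset> slen z" "snth z (slen y) = m"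
    "\<And>a. a \<sqsubset> slen z \<Longrightarrow> snth z a \<sqsubset> m \<oplus> \<one>" "\<And>a. a \<sqsubset> slen y \<Longrightarrow> snth z a = snth y a"
    using assms by (auto simp: valid_def opens_def extends_def less_succ_iff)
  have "ord_onto (slen z) (m \<oplus> \<one>) (snth z)"
  proof (rule ord_ontoI)
    show "\<exists>a. a \<sqsubset> slen z \<and> snth z a = i" if i: "i \<sqsubset> m \<oplus> \<one>" for i
    proof (cases "i = m")
      case False
      with i have "i \<sqsubset> m" by (simp add: lt_succ)
      then obtain a where "a \<sqsubset> slen y" "snth y a = i"
        using ord_ontoD(2)[OF y] by blast
      moreover from this z(2) have "a \<sqsubset> slen z" by order
      ultimately show ?thesis
        using z(5)[of a] by auto
    qed (use z in blast)
    fix b i assume b: "b \<sqsubset> slen z" "i \<sqsubset> snth z b"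
    show "\<exists>a. a \<sqsubset> b \<and> snth z a = i"
    proof (cases "b \<sqsubset> slen y")
      case True
      then obtain a where "a \<sqsubset> b" "snth y a = i"
        using ord_ontoD(3)[OF y, of b i] b z(5)[of b] by auto
      moreover from this True have "a \<sqsubset> slen y" by order
      ultimately show ?thesis
        using z(5)[of a] by auto
    next
      case False
      have "i \<sqsubset> m"
        using b(2) z(4)[OF b(1)] unfolding less_succ_iff by order
      then obtain a where "a \<sqsubset> slen y" "snth y a = i"
        using ord_ontoD(2)[OF y] by blast
      moreover from this False have "a \<sqsubset> b" by order
      ultimately show ?thesis
        using z(5)[of a] by auto
    qed
  qed (fact z)
  then show ?thesis
    using z(1) by (simp add: valid_def)
qed

lemma meets_extends:
  assumes "meets n x z u s" "extends z z'" shows "meets n x z' u s"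
proof -
  have le: "slen s \<sqsubseteq> slen z" "slen z \<sqsubseteq> slen z'"
    using assms by (auto simp: meets_def extends_def)
  have "snth z' a = snth z a" if "a \<sqsubset> slen s" for a
  proof -
    have "a \<sqsubset> slen z" using that le(1) by order
    then show ?thesis using assms(2) by (simp add: extends_def)
  qed
  moreover have "slen s \<sqsubseteq> slen z'" using le by order
  ultimately show ?thesis
    using assms(1) by (simp add: meets_def)
qed

text \<open>Density is applied to the string \<open>?t\<close>, which is \<open>x\<close> composed
  with \<open>z\<close>, and gives \<open>q\<close> and \<open>s\<close>. As \<open>x\<close> is
  onto \<open>k\<close>, each value \<open>q i\<close> has a preimage among the blocks up to
  \<open>m\<close>; appending such preimages to \<open>z\<close> makes the coarsening by
  \<open>x\<close> follow \<open>q\<close> past the end of \<open>s\<close>.\<close>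

lemma meet_one:
  assumes valid: "valid m y" and z: "opens m y z" and x: "x \<in> strings M k" "slen x = m \<oplus> \<one>"
  shows "\<exists>z' u s. opens m y z' \<and> extends z z' \<and> meets n x z' u s"
proof -
  let ?t = "restriction M (\<lambda>i. snth x (snth z i)) (slen z)"
  have "recf (\<lambda>i. snth x (snth z i))" by (intro rec_intros)
  note t = restriction[OF this, where m = "slen z"]
  have "ord_onto (slen z) (num M k) (\<lambda>i. snth x (snth z i))"
    by (rule ord_onto_comp[where c = "m \<oplus> \<one>"])
      (use valid_opens[OF valid z] x in \<open>simp_all add: valid_def strings_iff\<close>)
  then have "?t \<in> strings M k"
    using t ord_onto_cong[of "slen z" "\<lambda>i. snth x (snth z i)" "snth ?t"] by (simp add: strings_iff)
  then obtain q u s where q: "q \<in> cylinder M k ?t" "q \<in> cylinder M k s"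
    and s: "s \<in> strings M k" "W n u s"
    using W_dense by blast
  have q_part: "q \<in> k_partitions M k" and q_t: "\<And>i. i \<sqsubset> slen z \<Longrightarrow> q i = snth x (snth z i)"
    and q_s: "\<And>i. i \<sqsubset> slen s \<Longrightarrow> snth s i = q i"
    using q cylinder_iff[OF \<open>?t \<in> strings M k\<close>] cylinder_iff[OF s(1)] t by auto
  have q_less: "q i \<sqsubset> num M k" for i
    using q_part by (auto simp: partitions_iff below_def)
  have ex: "\<exists>v. v \<sqsubset> m \<oplus> \<one> \<and> snth x v = q i" for i
    using x q_less ord_ontoD(2) unfolding strings_iff by metis
  have rec_q: "recp2 (\<lambda>i v. snth x v = q i)"
    unfolding recp2_def by (intro rec_intros recf_comp[OF partitions_recf[OF q_part]])
  \<comment> \<open>The least preimage makes the lift recursive and, by \<open>ex\<close>, at most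
    \<open>m\<close>, so that no new block is opened.\<close>
  define v where "v i = least (\<lambda>v. snth x v = q i)" for i
  have v: "snth x (v i) = q i" "v i \<sqsubseteq> m" for i
  proof -
    obtain v' where v': "v' \<sqsubset> m \<oplus> \<one>" "snth x v' = q i" using ex by blast
    note l = least[OF recp2_arg[OF rec_q], OF v'(2)]
    show "snth x (v i) = q i" using l(1) by (simp add: v_def)
    show "v i \<sqsubseteq> m" using l(3)[OF v'(2)] v'(1) unfolding v_def less_succ_iff by order
  qed
  have "recf v"
    unfolding v_def using ex by (intro recf_least[OF rec_q]) blast
  let ?f = "\<lambda>i. if i \<sqsubset> slen z then snth z i else v i"
  \<comment> \<open>The sum of the lengths is a convenient length covering both \<open>z\<close> and
    \<open>s\<close>.\<close>
  let ?z = "restriction M ?f (slen z \<oplus> slen s)"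
  have "recf ?f" by (intro rec_intros recf_comp[OF \<open>recf v\<close>])
  note z' = restriction[OF this, where m = "slen z \<oplus> slen s"]
  have le: "slen z \<sqsubseteq> slen z \<oplus> slen s" "slen s \<sqsubseteq> slen z \<oplus> slen s" by simp_all
  have ext: "extends z ?z"
    unfolding extends_def z'(2)
  proof (intro conjI allI impI)
    fix a assume a: "a \<sqsubset> slen z"
    then have "a \<sqsubset> slen z \<oplus> slen s" using le(1) by order
    with a show "snth ?z a = snth z a" using z'(3)[of a] by simp
  qed (fact le(1))
  have "opens m y ?z"
    unfolding opens_def
  proof (intro conjI allI impI)
    show "extends y ?z"
      using z ext extends_trans by (auto simp: opens_def)
    show "slen y \<sqsubset> slen ?z"
      using z le(1) N.less_le_trans unfolding opens_def z'(2) by blast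
    show "snth ?z (slen y) = m"
      using z ext by (auto simp: opens_def extends_def)
    show "snth ?z a \<sqsubseteq> m" if "a \<sqsubset> slen ?z" for a
      using that z'(3)[of a] v(2) z unfolding z'(2) by (auto simp: opens_def)
  qed (fact z'(1))
  moreover have "meets n x ?z u s"
    unfolding meets_def z'(2)
  proof (intro conjI allI impI)
    fix a assume a: "a \<sqsubset> slen s"
    then have "a \<sqsubset> slen z \<oplus> slen s" using le(2) by order
    then show "snth s a = snth x (snth ?z a)"
      using z'(3)[of a] q_s[OF a] q_t[of a] v(1)[of a] by auto
  qed (use s le in auto)
  ultimately show ?thesis using ext by blast
qed

lemma recp_req [rec_intros]: "recf f \<Longrightarrow> recf g \<Longrightarrow> recp (\<lambda>x. req (f x) (g x))"
  unfolding req_def by (intro rec_intros)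

lemma recp_meets [rec_intros]:
  assumes "recf f" "recf g" "recf h" "recf u" "recf s"
  shows "recp (\<lambda>x. meets (f x) (g x) (h x) (u x) (s x))"
  unfolding meets_def
  by (intro rec_intros assms recf_comp[OF assms(1)] recf_comp[OF assms(2)] recf_comp[OF assms(3)]
      recf_comp[OF assms(4)] recf_comp[OF assms(5)])

lemma recp_meets_all [rec_intros]:
  assumes "recf f" "recf g" "recf h" "recf u"
  shows "recp (\<lambda>x. meets_all (f x) (g x) (h x) (u x))"
  unfolding meets_all_def
  by (intro rec_intros assms recf_comp[OF assms(1)] recf_comp[OF assms(2)] recf_comp[OF assms(3)])

lemma recp_extends [rec_intros]:
  assumes "recf f" "recf g" shows "recp (\<lambda>x. extends (f x) (g x))"
  unfolding extends_def
  by (intro rec_intros assms recf_comp[OF assms(1)] recf_comp[OF assms(2)])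

lemma recp_opens [rec_intros]:
  assumes "recf f" "recf g" "recf h" shows "recp (\<lambda>x. opens (f x) (g x) (h x))"
  unfolding opens_def
  by (intro rec_intros assms recf_comp[OF assms(1)] recf_comp[OF assms(2)] recf_comp[OF assms(3)])

lemma recp_valid [rec_intros]:
  assumes "recf f" "recf g" shows "recp (\<lambda>x. valid (f x) (g x))"
  unfolding valid_def by (intro rec_intros assms recp_ord_onto recf2_snth)

text \<open>Requirements are handled one number at a time by \<Sigma>1 induction on
  \<open>j\<close>. The witness \<open>v\<close> pairs the current string with the bound for all
  \<open>u\<close> and \<open>s\<close> found so far.\<close>

lemma ex_opens_meets_all:
  assumes "valid m y" shows "\<exists>v. opens m y (pfst v) \<and> meets_all m (pfst v) (psnd v) j"
proof (rule sigma1_induct)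
  show "recp2 (\<lambda>j v. opens m y (pfst v) \<and> meets_all m (pfst v) (psnd v) j)"
    unfolding recp2_def by (intro rec_intros)
  \<comment> \<open>The base case appends the single entry \<open>m\<close>, which opens the new
    block.\<close>
  have "recf (\<lambda>i. if i \<sqsubset> slen y then snth y i else m)" by (intro rec_intros)
  note z = restriction[OF this, where m = "slen y \<oplus> \<one>"]
  have "snth y a \<sqsubseteq> m" if "a \<sqsubset> slen y" for a
    using ord_ontoD(1)[of "slen y" m "snth y"] assms that by (simp add: valid_def leq_def)
  with z have "opens m y (restriction M (\<lambda>i. if i \<sqsubset> slen y then snth y i else m) (slen y \<oplus> \<one>))"
    by (auto simp: opens_def extends_def lt_succ)
  then show "\<exists>v. opens m y (pfst v) \<and> meets_all m (pfst v) (psnd v) \<zero>"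
    by (intro exI[of _ "pr _ \<zero>"]) (simp add: meets_all_def)
next
  fix j assume "\<exists>v. opens m y (pfst v) \<and> meets_all m (pfst v) (psnd v) j"
  then obtain z w where z: "opens m y z" "meets_all m z w j" by blast
  show "\<exists>v. opens m y (pfst v) \<and> meets_all m (pfst v) (psnd v) (j \<oplus> \<one>)"
  proof (cases "req m j")
    case False
    with z have "opens m y z" "meets_all m z w (j \<oplus> \<one>)"
      by (auto simp: meets_all_def lt_succ)
    then show ?thesis by (intro exI[of _ "pr z w"]) simp
  next
    case True
    then obtain z' u s where z': "opens m y z'" "extends z z'" "meets (pfst j) (psnd j) z' u s"
      using meet_one[OF assms z(1), of "psnd j" "pfst j"] by (auto simp: req_def)
    \<comment> \<open>Chosen to exceed the old bound and both new witnesses.\<close>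
    define w' where "w' = w \<oplus> (u \<oplus> s) \<oplus> \<one>"
    have le: "w \<sqsubseteq> w \<oplus> (u \<oplus> s)" "u \<sqsubseteq> w \<oplus> (u \<oplus> s)" "s \<sqsubseteq> w \<oplus> (u \<oplus> s)"
    proof -
      have "u \<oplus> s \<sqsubseteq> w \<oplus> (u \<oplus> s)" "u \<sqsubseteq> u \<oplus> s" "s \<sqsubseteq> u \<oplus> s" by simp_all
      then show "u \<sqsubseteq> w \<oplus> (u \<oplus> s)" "s \<sqsubseteq> w \<oplus> (u \<oplus> s)" by order+
    qed simp
    have "meets_all m z' w' (j \<oplus> \<one>)"
      unfolding meets_all_def
    proof (intro allI impI)
      fix r assume r: "r \<sqsubset> j \<oplus> \<one>" "req m r"
      show "\<exists>u. u \<sqsubset> w' \<and> (\<exists>s. s \<sqsubset> w' \<and> meets (pfst r) (psnd r) z' u s)"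
      proof (cases "r = j")
        case True
        then show ?thesis
          using z'(3) le by (auto simp: w'_def less_succ_iff)
      next
        case False
        with r have "r \<sqsubset> j" by (simp add: lt_succ)
        then obtain u' s' where "u' \<sqsubset> w" "s' \<sqsubset> w" "meets (pfst r) (psnd r) z u' s'"
          using z(2) r(2) unfolding meets_all_def by blast
        moreover have "w \<sqsubset> w'"
          using le(1) by (simp add: w'_def less_succ_iff)
        ultimately show ?thesis
          using meets_extends z'(2) N.less_trans by blast
      qed
    qed
    with z'(1) show ?thesis by (intro exI[of _ "pr z' w'"]) simp
  qed
qed

section \<open>The stages and their limit\<close>

definition req_bound :: "'a \<Rightarrow> 'a" where
  "req_bound m = pr m (code_bound (pr (m \<oplus> \<one>) (num M k))) \<oplus> \<one>"

text \<open>Sequence codes are unique, so \<open>x\<close> coincides with the code that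
  \<open>seq_ex_bounded\<close> builds from its entries, and inherits its bound.\<close>

lemma req_bound:
  assumes "n \<sqsubseteq> m" "x \<in> strings M k" "slen x = m \<oplus> \<one>"
  shows "pr n x \<sqsubset> req_bound m"
proof -
  have "recf (snth x)" by (intro rec_intros)
  moreover have less: "snth x i \<sqsubset> num M k" if "i \<sqsubset> m \<oplus> \<one>" for i
    using assms that by (simp add: strings_iff ord_onto_def)
  ultimately obtain s where s: "s \<in> seqs M" "seq_len M s = m \<oplus> \<one>"
    "\<And>i. i \<sqsubset> m \<oplus> \<one> \<Longrightarrow> seq_nth M s i = snth x i" "s \<sqsubseteq> code_bound (pr (m \<oplus> \<one>) (num M k))"
    using seq_ex_bounded by blast
  have "s = x"
  proof (rule seqs_snth_eqI)
    show len: "slen s = slen x" using s(1,2) assms(3) by (simp add: seqs_slen)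
    show "snth s i = snth x i" if "i \<sqsubset> slen s" for i
      using s(1,2) s(3)[of i] that len assms(3) by (simp add: seqs_snth)
  qed (fact s(1) strings_seqs[OF assms(2)])+
  then show ?thesis
    using assms(1) s(4) by (simp add: req_bound_def less_succ_iff pr_mono)
qed

text \<open>Primitive recursion asks for a total function; the premise \<open>valid m y\<close> lets
  the search succeed trivially on other inputs.\<close>

definition stage :: "'a \<Rightarrow> 'a \<Rightarrow> 'a" where
  "stage m y = pfst (least (\<lambda>v. valid m y \<longrightarrow>
    opens m y (pfst v) \<and> meets_all m (pfst v) (psnd v) (req_bound m)))"

lemma recf2_stage: "recf2 stage"
  unfolding stage_def recf2_def req_bound_def
proof (intro recf_comp[OF recf_pfst] recf_least)
  show "\<exists>v. valid (pfst x) (psnd x) \<longrightarrow> opens (pfst x) (psnd x) (pfst v) \<and>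
      meets_all (pfst x) (pfst v) (psnd v) (pr (pfst x) (code_bound (pr (pfst x \<oplus> \<one>) (num M k))) \<oplus> \<one>)" for x
    using ex_opens_meets_all by blast
qed (unfold recp2_def, intro rec_intros recf_comp[OF recf_code_bound])

lemma stage:
  assumes "valid m y"
  shows "opens m y (stage m y)" "\<exists>w. meets_all m (stage m y) w (req_bound m)"
proof -
  let ?P = "\<lambda>v. valid m y \<longrightarrow> opens m y (pfst v) \<and> meets_all m (pfst v) (psnd v) (req_bound m)"
  have "recp ?P" by (intro rec_intros)
  moreover obtain v where "?P v" using ex_opens_meets_all[OF assms] by blast
  ultimately have "?P (least ?P)" by (rule least(1))
  then show "opens m y (stage m y)" "\<exists>w. meets_all m (stage m y) w (req_bound m)"
    using assms unfolding stage_def by blast+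
qed

text \<open>The stages iterate to a growing chain \<open>F\<close> with limit \<open>y\<close>. The
  clause \<open>y a \<le> m\<close> says that \<open>s\<close> consults \<open>x\<close> only inside
  its length \<open>m + 1\<close>.\<close>

lemma fusion:
  "\<exists>y\<in>omega_partitions M. \<forall>m n x. n \<sqsubseteq> m \<longrightarrow> x \<in> strings M k \<longrightarrow> slen x = m \<oplus> \<one> \<longrightarrow>
    (\<exists>u s. W n u s \<and> (\<forall>a. a \<sqsubset> slen s \<longrightarrow> y a \<sqsubseteq> m \<and> snth s a = snth x (y a)))"
proof -
  note empty = restriction[OF recf_id, where m = \<zero>]
  obtain F where F: "recf F" "F \<zero> = restriction M (\<lambda>x. x) \<zero>" "\<And>m. F (m \<oplus> \<one>) = stage m (F m)"
    using prim_rec[OF recf2_stage] by blast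
  have valid: "valid m (F m)" for m
  proof (rule rec_induct[where P = "\<lambda>m. valid m (F m)"])
    show "recp (\<lambda>m. valid m (F m))"
      by (intro rec_intros F(1))
    show "valid \<zero> (F \<zero>)"
      using empty by (simp add: valid_def F(2) ord_onto_def)
    show "valid (m \<oplus> \<one>) (F (m \<oplus> \<one>))" if "valid m (F m)" for m
      using valid_opens[OF that stage(1)[OF that]] by (simp add: F(3))
  qed
  have opens: "opens m (F m) (F (m \<oplus> \<one>))" for m
    using stage(1)[OF valid] by (simp add: F(3))
  have extends: "extends (F m) (F (m \<oplus> d))" for m d
  proof (rule rec_induct[where P = "\<lambda>d. extends (F m) (F (m \<oplus> d))"])
    show "recp (\<lambda>d. extends (F m) (F (m \<oplus> d)))"
      by (intro rec_intros recf_comp[OF F(1)])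
    show "extends (F m) (F (m \<oplus> \<zero>))"
      by (simp add: extends_def)
    show "extends (F m) (F (m \<oplus> (d \<oplus> \<one>)))" if "extends (F m) (F (m \<oplus> d))" for d
      using extends_trans[OF that] opens[of "m \<oplus> d"] by (simp add: opens_def add_succ)
  qed
  have len: "m \<sqsubseteq> slen (F m)" for m
  proof (rule rec_induct[where P = "\<lambda>m. m \<sqsubseteq> slen (F m)"])
    show "recp (\<lambda>m. m \<sqsubseteq> slen (F m))"
      by (intro rec_intros F(1))
    show "m \<oplus> \<one> \<sqsubseteq> slen (F (m \<oplus> \<one>))" if "m \<sqsubseteq> slen (F m)" for m
      using opens[of m] that N.le_less_trans unfolding opens_def succ_leq_iff by blast
  qed simp
  \<comment> \<open>By \<open>len\<close>, the string \<open>F (i + 1)\<close> is long enough to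
    have an entry at \<open>i\<close>.\<close>
  define y where "y i = snth (F (i \<oplus> \<one>)) i" for i
  have y: "snth (F m) a = y a" if a: "a \<sqsubset> slen (F m)" for m a
  proof (cases "m \<sqsubseteq> a \<oplus> \<one>")
    case True
    then obtain d where "a \<oplus> \<one> = m \<oplus> d" using leqE by blast
    then show ?thesis
      using extends[of m d] a by (auto simp: y_def extends_def)
  next
    case False
    then have "a \<oplus> \<one> \<sqsubseteq> m" using leq_linear by blast
    then obtain d where "m = a \<oplus> \<one> \<oplus> d" using leqE by blast
    moreover have "a \<sqsubset> slen (F (a \<oplus> \<one>))"
      using len[of "a \<oplus> \<one>"] by (simp add: succ_leq_iff)
    ultimately show ?thesis
      using extends[of "a \<oplus> \<one>" d] by (auto simp: y_def extends_def)
  qed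
  have "y \<in> omega_partitions M"
    unfolding partitions_iff
  proof (intro conjI ballI allI impI)
    show "recf y"
      unfolding y_def by (intro rec_intros recf_comp[OF F(1)])
    \<comment> \<open>Stage \<open>m\<close> opens block \<open>m\<close> at this very position,
      which yields surjectivity.\<close>
    have "y (slen (F m)) = m" for m
      using y[of "slen (F m)" "m \<oplus> \<one>"] opens[of m] by (simp add: opens_def)
    then show "range y = UNIV" by (rule surjI)
    fix i j b assume "i \<sqsubset> j" "y b = j"
    moreover have b: "b \<sqsubset> slen (F (b \<oplus> \<one>))"
      using len[of "b \<oplus> \<one>"] by (simp add: succ_leq_iff)
    ultimately obtain a where "a \<sqsubset> b" "snth (F (b \<oplus> \<one>)) a = i"
      using valid[of "b \<oplus> \<one>"] ord_ontoD(3)[of "slen (F (b \<oplus> \<one>))" "b \<oplus> \<one>" "snth (F (b \<oplus> \<one>))" b i]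
      by (auto simp: valid_def y)
    moreover from this b have "a \<sqsubset> slen (F (b \<oplus> \<one>))" by order
    ultimately show "\<exists>a. a \<sqsubset> b \<and> y a = i"
      using y by auto
  qed
  moreover have "\<exists>u s. W n u s \<and> (\<forall>a. a \<sqsubset> slen s \<longrightarrow> y a \<sqsubseteq> m \<and> snth s a = snth x (y a))"
    if nx: "n \<sqsubseteq> m" "x \<in> strings M k" "slen x = m \<oplus> \<one>" for m n x
  proof -
    obtain w where "meets_all m (F (m \<oplus> \<one>)) w (req_bound m)"
      using stage(2)[OF valid] by (auto simp: F(3))
    moreover have "req m (pr n x)"
      using nx by (simp add: req_def)
    ultimately obtain u s where us: "meets n x (F (m \<oplus> \<one>)) u s"
      using req_bound[OF nx] unfolding meets_all_def by fastforce
    have "y a \<sqsubseteq> m \<and> snth s a = snth x (y a)" if a: "a \<sqsubset> slen s" for a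
    proof -
      have "a \<sqsubset> slen (F (m \<oplus> \<one>))"
        using us a N.less_le_trans unfolding meets_def by blast
      then show ?thesis
        using y[of a "m \<oplus> \<one>"] us a opens[of m] by (auto simp: meets_def opens_def)
    qed
    moreover have "W n u s" using us by (simp add: meets_def)
    ultimately show ?thesis by blast
  qed
  ultimately show ?thesis by blast
qed

end

context rca0
begin

lemma model_funs_strings:
  assumes "recf c" "\<And>t. t \<in> strings M k \<Longrightarrow> c t \<in> B"
  shows "c \<in> model_funs M (strings M k) B"
proof -
  have "recp (\<lambda>z. z = pr (pfst z) (c (pfst z)) \<and> pfst z \<in> strings M k)"
    by (intro rec_intros recf_comp[OF assms(1)])
  moreover have "z = pr (pfst z) (c (pfst z)) \<and> pfst z \<in> strings M k \<longleftrightarrow>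
      (\<exists>t. z = pr t (c t) \<and> t \<in> strings M k)" for z
    by auto
  ultimately show ?thesis
    using assms(2) by (auto simp: model_funs_def recp_def)
qed

text \<open>Places the start of the last block right after \<open>t\<close>. This turns a string
  coloring argument into a string of length \<open>slen t + 1\<close> to which the requirements of
  stage \<open>slen t\<close> apply.\<close>

lemma snoc_strings:
  assumes "t \<in> strings M (k - 1)" "k > 0"
  defines "f \<equiv> \<lambda>i. if i \<sqsubset> slen t then snth t i else num M (k - 1)"
  shows "restriction M f (slen t \<oplus> \<one>) \<in> strings M k"
proof -
  let ?K = "num M (k - 1)" and ?s = "restriction M f (slen t \<oplus> \<one>)"
  have t: "ord_onto (slen t) ?K (snth t)"
    using assms(1) by (simp add: strings_iff)
  have "recf f" unfolding f_def by (intro rec_intros)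
  note s = restriction[OF this, where m = "slen t \<oplus> \<one>"]
  have "ord_onto (slen t \<oplus> \<one>) (?K \<oplus> \<one>) f"
  proof (rule ord_ontoI)
    show "f a \<sqsubset> ?K \<oplus> \<one>" for a
      using ord_ontoD(1)[OF t] by (simp add: f_def lt_succ)
    show "\<exists>a. a \<sqsubset> slen t \<oplus> \<one> \<and> f a = i" if "i \<sqsubset> ?K \<oplus> \<one>" for i
    proof (cases "i = ?K")
      case True
      then show ?thesis by (intro exI[of _ "slen t"]) (simp add: f_def lt_succ)
    next
      case False
      with that have "i \<sqsubset> ?K" by (simp add: lt_succ)
      then obtain a where "a \<sqsubset> slen t" "snth t a = i"
        using ord_ontoD(2)[OF t] by blast
      then show ?thesis by (intro exI[of _ a]) (simp add: f_def lt_succ)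
    qed
    fix b i assume b: "b \<sqsubset> slen t \<oplus> \<one>" "i \<sqsubset> f b"
    have "\<exists>a. a \<sqsubset> b \<and> a \<sqsubset> slen t \<and> snth t a = i"
    proof (cases "b \<sqsubset> slen t")
      case True
      then obtain a where "a \<sqsubset> b" "snth t a = i"
        using ord_ontoD(3)[OF t, of b i] b(2) by (auto simp: f_def)
      moreover from this True have "a \<sqsubset> slen t" by order
      ultimately show ?thesis by blast
    next
      case False
      with b show ?thesis
        using ord_ontoD(2)[OF t, of i] by (auto simp: f_def lt_succ)
    qed
    then show "\<exists>a. a \<sqsubset> b \<and> f a = i"
      by (auto simp: f_def)
  qed
  then show ?thesis
    using s ord_onto_cong[of "slen t \<oplus> \<one>" f "snth ?s"] num_pos[OF assms(2)] by (simp add: strings_iff)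
qed

text \<open>For \<open>t\<close> of length \<open>m\<close>, the requirements met along
  \<open>y\<close> at stage \<open>m\<close> decide a color for \<open>t\<close> followed by the
  last block, and \<open>c t\<close> is that color. The same \<open>y\<close> makes every coarsening
  \<open>x \<circ> y\<close> meet each \<open>D n\<close> at a later stage, so homogeneity for
  \<open>c\<close> alone suffices.\<close>

lemma CDRT_imp_Baire_DRT:
  assumes "CDRT M k l" "k > 0" shows "Baire_DRT M k l"
  unfolding Baire_DRT_def
proof (intro allI impI)
  let ?K = "num M (k - 1)"
  fix U D assume UD: "baire_coloring M k l U D"
  \<comment> \<open>Requirement 0 asks for a color, which is stored in the first component of \<open>u\<close>;
      requirement \<open>n + 1\<close> asks for membership in \<open>D\<^sub>n\<close>.\<close>
  define W where "W n u s \<longleftrightarrow> s \<in> strings M k \<and>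
    (n = \<zero> \<and> pfst u \<sqsubset> num M l \<and> pr (pfst u) (pr (psnd u) s) \<in> U \<or>
     (\<exists>n'. n' \<sqsubset> n \<and> n = n' \<oplus> \<one> \<and> pr n' (pr u s) \<in> D))" for n u s
  have sets: "U \<in> set_part M" "D \<in> set_part M"
    using UD by (auto simp: baire_coloring_def disjoint_open_seq_def)
  interpret dense_requirements M k W
  proof
    show "recp (\<lambda>z. W (pfst z) (pfst (psnd z)) (psnd (psnd z)))"
      unfolding W_def by (intro rec_intros sets)
    fix t n assume t: "t \<in> strings M k"
    show "\<exists>q u s. q \<in> cylinder M k t \<and> s \<in> strings M k \<and> q \<in> cylinder M k s \<and> W n u s"
    proof (cases "n = \<zero>")
      case True
      obtain q i where "q \<in> cylinder M k t" "i \<sqsubset> num M l" "q \<in> open_set M k (row M U i)"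
        using UD t unfolding baire_coloring_def is_dense_def below_def by blast
      then obtain u s where "s \<in> strings M k" "q \<in> cylinder M k s" "W n (pr i u) s"
        unfolding open_set_def row_def W_def True by auto
      with \<open>q \<in> cylinder M k t\<close> show ?thesis by blast
    next
      case False
      then obtain n' where n': "n = n' \<oplus> \<one>"
        using zero_or_succ by blast
      obtain q where "q \<in> cylinder M k t" "q \<in> open_set M k (row M D n')"
        using UD t unfolding baire_coloring_def is_dense_def by blast
      then obtain u s where "s \<in> strings M k" "q \<in> cylinder M k s" "W n u s"
        unfolding open_set_def row_def W_def n' by (auto simp: lt_succ)
      with \<open>q \<in> cylinder M k t\<close> show ?thesis by blast
    qed
  qed (fact assms(2))
  obtain y where y: "y \<in> omega_partitions M"
    and y_meets: "\<And>m n x. n \<sqsubseteq> m \<Longrightarrow> x \<in> strings M k \<Longrightarrow> slen x = m \<oplus> \<one> \<Longrightarrow>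
      \<exists>u s. W n u s \<and> (\<forall>a. a \<sqsubset> slen s \<longrightarrow> y a \<sqsubseteq> m \<and> snth s a = snth x (y a))"
    using fusion by blast
  have "recf y" using y partitions_recf by blast
  \<comment> \<open>Here \<open>v\<close> pairs \<open>u\<close> with \<open>s\<close>, and the
    value at \<open>y a\<close> is that of \<open>t\<close> extended by \<open>?K\<close>. Strings
    of the wrong kind satisfy \<open>P\<close> trivially, so that the least \<open>v\<close> is a
    total function of \<open>t\<close>.\<close>
  define P where "P t v \<longleftrightarrow> (t \<in> strings M (k - 1) \<longrightarrow> W \<zero> (pfst v) (psnd v) \<and>
      (\<forall>a. a \<sqsubset> slen (psnd v) \<longrightarrow> y a \<sqsubseteq> slen t \<and>
        snth (psnd v) a = (if y a \<sqsubset> slen t then snth t (y a) else ?K)))" for t v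
  have rec_P: "recp2 P"
    unfolding recp2_def P_def by (intro rec_intros recf_comp[OF \<open>recf y\<close>])
  have ex_P: "\<exists>v. P t v" for t
  proof (cases "t \<in> strings M (k - 1)")
    case True
    let ?f = "\<lambda>i. if i \<sqsubset> slen t then snth t i else ?K"
    have "recf ?f" by (intro rec_intros)
    note x = restriction[OF this, where m = "slen t \<oplus> \<one>"]
    obtain u s where us: "W \<zero> u s" "\<And>a. a \<sqsubset> slen s \<Longrightarrow> y a \<sqsubseteq> slen t \<and>
        snth s a = snth (restriction M ?f (slen t \<oplus> \<one>)) (y a)"
      using y_meets[OF zero_leq snoc_strings[OF True assms(2)] x(2)] by blast
    then have "P t (pr u s)"
      using x(3) by (simp add: P_def less_succ_iff)
    then show ?thesis ..
  qed (simp add: P_def)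
  define c where "c t = pfst (pfst (least (P t)))" for t
  have "recf c"
    unfolding c_def by (intro rec_intros recf_least[OF rec_P ex_P])
  have P_least: "P t (least (P t))" for t
    using least(1)[OF recp2_arg[OF rec_P]] ex_P by blast
  have "c t \<in> below M (num M l)" if "t \<in> strings M (k - 1)" for t
    using P_least[of t] that by (auto simp: P_def W_def c_def below_def)
  then have "c \<in> model_funs M (strings M (k - 1)) (below M (num M l))"
    by (rule model_funs_strings[OF \<open>recf c\<close>])
  then obtain p i where p: "p \<in> omega_partitions M" and i: "i \<in> below M (num M l)"
    and color: "\<And>x. x \<in> coarsenings M p k \<Longrightarrow> c (star M k x) = i"
    using assms(1) unfolding CDRT_def by blast
  have "q \<in> open_set M k (row M U i) \<inter> (\<Inter>n. open_set M k (row M D n))"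
    if q_mem: "q \<in> coarsenings M (p \<circ> y) k" for q
  proof -
    \<comment> \<open>Reassociating the composition exposes a coarsening of \<open>p\<close>, to
      which homogeneity applies.\<close>
    obtain x where x: "x \<in> coarsenings M p k" and q: "q = x \<circ> y"
    proof -
      obtain z where "z \<in> k_partitions M k" "q = z \<circ> (p \<circ> y)"
        using q_mem by (auto simp: coarsenings_def)
      then show thesis
        by (intro that[of "z \<circ> p"]) (auto simp: coarsenings_def comp_assoc)
    qed
    have x_part: "x \<in> k_partitions M k"
      using coarsenings_k_partitions[OF p x] .
    then have q_part: "q \<in> k_partitions M k"
      using partitions_comp y q by blast
    define m where "m = block_min M x ?K"
    define t where "t = star M k x"
    have t: "t \<in> strings M (k - 1)" "slen t = m" "\<And>a. a \<sqsubset> m \<Longrightarrow> snth t a = x a"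
      using star[OF x_part assms(2)] by (auto simp: t_def m_def)
    define u where "u = pfst (least (P t))"
    define s where "s = psnd (least (P t))"
    have "pfst u = i"
      using color[OF x] by (simp add: c_def t_def u_def)
    have us: "W \<zero> u s" "\<And>a. a \<sqsubset> slen s \<Longrightarrow> y a \<sqsubseteq> m \<and> snth s a = (if y a \<sqsubset> m then snth t (y a) else ?K)"
      using P_least[of t] t(1,2) by (auto simp: P_def u_def s_def)
    have "x m = ?K"
      unfolding m_def by (rule k_partitions_block_min[OF x_part assms(2)])
    then have "snth s a = q a" if "a \<sqsubset> slen s" for a
      using us(2)[OF that] t(3)[of "y a"] by (auto simp: q leq_def)
    then have "q \<in> open_set M k (row M U i)"
      unfolding open_set_iff using q_part us(1) \<open>pfst u = i\<close> by (auto simp: W_def row_def)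
    moreover have "q \<in> open_set M k (row M D n)" for n
    proof -
      \<comment> \<open>Large enough for two purposes: requirement \<open>n + 1\<close> is treated
        at this stage, and restricting \<open>x\<close> to \<open>?m + 1\<close> includes the start
        \<open>m\<close> of its last block.\<close>
      let ?m = "m \<oplus> (n \<oplus> \<one>)"
      let ?x = "restriction M x (?m \<oplus> \<one>)"
      have "m \<sqsubset> ?m \<oplus> \<one>"
        unfolding less_succ_iff by (simp add: leq_iff)
      then have "?x \<in> strings M k"
        using restriction_strings[OF x_part assms(2)] by (simp add: m_def)
      moreover note r = restriction[OF partitions_recf[OF x_part], where m = "?m \<oplus> \<one>"]
      moreover have "n \<oplus> \<one> \<sqsubseteq> ?m" by simp
      ultimately obtain u s where us: "W (n \<oplus> \<one>) u s"
        "\<And>a. a \<sqsubset> slen s \<Longrightarrow> y a \<sqsubseteq> ?m \<and> snth s a = snth ?x (y a)"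
        using y_meets by blast
      have "snth s a = q a" if "a \<sqsubset> slen s" for a
        using us(2)[OF that] r(3)[of "y a"] by (simp add: q less_succ_iff)
      moreover have "s \<in> strings M k" "pr n (pr u s) \<in> D"
        using us(1) by (auto simp: W_def dest: succ_inj)
      ultimately show ?thesis
        unfolding open_set_iff using q_part by (auto simp: row_def)
    qed
    ultimately show ?thesis by blast
  qed
  then show "\<exists>p\<in>omega_partitions M. \<exists>i\<in>below M (num M l). \<forall>x\<in>coarsenings M p k.
      x \<in> open_set M k (row M U i) \<inter> (\<Inter>n. open_set M k (row M D n))"
    using partitions_comp[OF p y] i by blast
qed

end

theorem theorem1p1:
  fixes M :: "'a l2_structure" and k l :: nat
  assumes "RCA0 M" and "k \<ge> 2" and "l \<ge> 2"
  shows "(Baire_DRT M k l \<longleftrightarrow> ODRT M k l) \<and> (ODRT M k l \<longleftrightarrow> CDRT M k l)"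
proof -
  interpret rca0 M
    by unfold_locales (fact assms(1))
  have "k > 0" using assms(2) by simp
  then show ?thesis
    using Baire_DRT_imp_ODRT ODRT_imp_CDRT CDRT_imp_Baire_DRT by blast
qed

end
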